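(* Let $K=\mathbb{F}_3$ and let $S$ be a smooth cubic surface over $K$. Suppose $S$ contains a skew pair of lines $\ell,\ell'$ defined over $K$, and that each of $\ell$ and $\ell'$ contains at most one $K$-rational Eckardt point. Then there exists a point $P\in\ell(K)\cup\ell'(K)$ such that $\mathrm{Span}(P)=S(K)$.
   Context: A smooth cubic surface $S$ over $K$ is a nonsingular surface in $\mathbb{P}^3$ defined by a homogeneous cubic polynomial over $K$. A $K$-line is a line in $\mathbb{P}^3$ defined over $K$. A line "on $S$" means a line over $\overline{K}$ contained in $S$. A skew pair of lines is a pair of disjoint lines. An Eckardt point is a point of $S$ through which three of the lines on $S$ pass. For a line $\ell\not\subset S$, $\ell\cdot S=P+Q+R$ with multiplicity. For $B\subseteq S(K)$ define $B_0=B$ and $B_{n+1}$ as the set of $R\in S(K)$ such that either $R\in B_n$ or there exist $P,Q\in B_n$ and a $K$-line $\ell\not\subset S$ with $\ell\cdot S=P+Q+R$; $\mathrm{Span}(B)=\bigcup_n B_n$, and $\mathrm{Span}(P)=\mathrm{Span}(\{P\})$. *)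

theory Defs
  imports "HOL-Algebra.Algebraic_Closure_Type" "Berlekamp_Zassenhaus.Finite_Field"
    "HOL-Analysis.Finite_Cartesian_Product"
begin

typedef three = "{0::nat, 1, 2}" by auto

lemma card_three: "CARD(three) = 3"
proof -
  have "CARD(three) = card {0::nat, 1, 2}"
    using type_definition.card[OF type_definition_three] by simp
  thus ?thesis by simp
qed

instance three :: finite
proof
  show "finite (UNIV :: three set)"
    using type_definition.Abs_image[OF type_definition_three]
    by (metis finite.emptyI finite_imageI finite_insert)
qed

instance three :: prime_card
  by standard (simp add: card_three)

type_synonym f3 = "three mod_ring"
type_synonym fb = "f3 alg_closure"

definition smul :: "'a::times \<Rightarrow> 'a^4 \<Rightarrow> 'a^4" where
  "smul a v = (\<chi> i. a * v$i)"

definition vadd :: "'a::plus^4 \<Rightarrow> 'a^4 \<Rightarrow> 'a^4" where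
  "vadd v w = (\<chi> i. v$i + w$i)"

definition vzero :: "'a::zero^4" where
  "vzero = (\<chi> i. 0)"

definition vmap :: "f3^4 \<Rightarrow> fb^4" where
  "vmap v = (\<chi> i. to_ac (v$i))"

definition indep2 :: "'a::field^4 \<Rightarrow> 'a^4 \<Rightarrow> bool" where
  "indep2 u w \<longleftrightarrow> (\<forall>a b. vadd (smul a u) (smul b w) = vzero \<longrightarrow> a = 0 \<and> b = 0)"

text \<open>Projective K-point represented by a nonzero vector v of K^4: its class under scaling.\<close>
definition kpt :: "f3^4 \<Rightarrow> (f3^4) set" where
  "kpt v = {smul a v | a. a \<noteq> 0}"

text \<open>A homogeneous cubic form over K is given by its coefficients c e for the
  exponent vectors e with total degree 3.\<close>
definition mons3 :: "(nat^4) set" where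
  "mons3 = {e. (\<Sum>i\<in>UNIV. e$i) = 3}"

definition ev :: "(nat^4 \<Rightarrow> 'a::comm_ring_1) \<Rightarrow> 'a^4 \<Rightarrow> 'a" where
  "ev c x = (\<Sum>e\<in>mons3. c e * (\<Prod>i\<in>UNIV. x$i ^ e$i))"

definition dev :: "(nat^4 \<Rightarrow> 'a::comm_ring_1) \<Rightarrow> 4 \<Rightarrow> 'a^4 \<Rightarrow> 'a" where
  "dev c j x = (\<Sum>e\<in>mons3. of_nat (e$j) * c e *
                   (\<Prod>i\<in>UNIV. x$i ^ (if i = j then e$i - 1 else e$i)))"

definition cbar :: "(nat^4 \<Rightarrow> f3) \<Rightarrow> nat^4 \<Rightarrow> fb" where
  "cbar c = to_ac \<circ> c"

definition smooth_cubic :: "(nat^4 \<Rightarrow> f3) \<Rightarrow> bool" where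
  "smooth_cubic c \<longleftrightarrow>
     (\<forall>x::fb^4. x \<noteq> vzero \<longrightarrow> ev (cbar c) x = 0 \<longrightarrow> (\<exists>j. dev (cbar c) j x \<noteq> 0))"

definition SK :: "(nat^4 \<Rightarrow> f3) \<Rightarrow> (f3^4) set set" where
  "SK c = {kpt v | v. v \<noteq> vzero \<and> ev c v = 0}"

definition line_of :: "fb^4 \<Rightarrow> fb^4 \<Rightarrow> (fb^4) set" where
  "line_of u w = {vadd (smul a u) (smul b w) | a b. (a, b) \<noteq> (0, 0)}"

definition lines_on :: "(nat^4 \<Rightarrow> f3) \<Rightarrow> (fb^4) set set" where
  "lines_on c = {line_of u w | u w. indep2 u w \<and> (\<forall>x\<in>line_of u w. ev (cbar c) x = 0)}"

definition eckardt :: "(nat^4 \<Rightarrow> f3) \<Rightarrow> fb^4 \<Rightarrow> bool" where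
  "eckardt c x \<longleftrightarrow> x \<noteq> vzero \<and> ev (cbar c) x = 0 \<and>
     (\<exists>L1 L2 L3. L1 \<in> lines_on c \<and> L2 \<in> lines_on c \<and> L3 \<in> lines_on c \<and>
        L1 \<noteq> L2 \<and> L1 \<noteq> L3 \<and> L2 \<noteq> L3 \<and> x \<in> L1 \<and> x \<in> L2 \<and> x \<in> L3)"

definition Kpts_line :: "f3^4 \<Rightarrow> f3^4 \<Rightarrow> (f3^4) set" where
  "Kpts_line u w = {vadd (smul a u) (smul b w) | a b. (a, b) \<noteq> (0, 0)}"

definition K_line_on :: "(nat^4 \<Rightarrow> f3) \<Rightarrow> f3^4 \<Rightarrow> f3^4 \<Rightarrow> bool" where
  "K_line_on c u w \<longleftrightarrow> indep2 u w \<and> line_of (vmap u) (vmap w) \<in> lines_on c"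

definition skew :: "f3^4 \<Rightarrow> f3^4 \<Rightarrow> f3^4 \<Rightarrow> f3^4 \<Rightarrow> bool" where
  "skew u w u' w' \<longleftrightarrow> line_of (vmap u) (vmap w) \<inter> line_of (vmap u') (vmap w') = {}"

definition at_most_one_K_eckardt :: "(nat^4 \<Rightarrow> f3) \<Rightarrow> f3^4 \<Rightarrow> f3^4 \<Rightarrow> bool" where
  "at_most_one_K_eckardt c u w \<longleftrightarrow>
     (\<forall>v v'. v \<in> Kpts_line u w \<longrightarrow> v' \<in> Kpts_line u w \<longrightarrow>
        eckardt c (vmap v) \<longrightarrow> eckardt c (vmap v') \<longrightarrow> kpt v = kpt v')"

text \<open>third c P Q R: there is a K-line l, not contained in S, with l.S = P + Q + R
  (with multiplicity). The line is spanned by independent u, w over K; the points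
  have parameters (p0,p1), (q0,q1), (r0,r1) in K^2, and the restriction of the cubic
  to l is, as a binary cubic form over Kbar, a nonzero multiple of the product of the
  linear forms vanishing at these parameters.\<close>
definition third :: "(nat^4 \<Rightarrow> f3) \<Rightarrow> (f3^4) set \<Rightarrow> (f3^4) set \<Rightarrow> (f3^4) set \<Rightarrow> bool" where
  "third c P Q R \<longleftrightarrow>
    (\<exists>u w p0 p1 q0 q1 r0 r1 lam.
       indep2 u w \<and>
       \<not> (\<forall>x\<in>line_of (vmap u) (vmap w). ev (cbar c) x = 0) \<and>
       (p0, p1) \<noteq> (0, 0) \<and> (q0, q1) \<noteq> (0, 0) \<and> (r0, r1) \<noteq> (0, 0) \<and>
       P = kpt (vadd (smul p0 u) (smul p1 w)) \<and>
       Q = kpt (vadd (smul q0 u) (smul q1 w)) \<and>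
       R = kpt (vadd (smul r0 u) (smul r1 w)) \<and>
       lam \<noteq> (0::fb) \<and>
       (\<forall>s t::fb. ev (cbar c) (vadd (smul s (vmap u)) (smul t (vmap w))) =
          lam * (to_ac p1 * s - to_ac p0 * t) * (to_ac q1 * s - to_ac q0 * t)
              * (to_ac r1 * s - to_ac r0 * t)))"

fun Bstep :: "(nat^4 \<Rightarrow> f3) \<Rightarrow> (f3^4) set set \<Rightarrow> nat \<Rightarrow> (f3^4) set set" where
  "Bstep c B 0 = B"
| "Bstep c B (Suc n) = {R \<in> SK c. R \<in> Bstep c B n \<or>
      (\<exists>P Q. P \<in> Bstep c B n \<and> Q \<in> Bstep c B n \<and> third c P Q R)}"

definition Span :: "(nat^4 \<Rightarrow> f3) \<Rightarrow> (f3^4) set set \<Rightarrow> (f3^4) set set" where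
  "Span c B = (\<Union>n. Bstep c B n)"

end

theory Submission
  imports Defs
begin

text \<open>
  Let $x$ and $y$ be coordinates on the skew lines $\ell$ and $\ell'$, so that the cubic is
  $F(x,y) = \alpha(x,y) + \beta(x,y)$ with $\alpha$ of bidegree $(2,1)$ and $\beta$ of bidegree $(1,2)$.
  By smoothness $\alpha(x,y) = 0$ and $\beta(x,y) = 0$ are the graphs of maps of degree two
  $f : \ell \to \ell'$ and $g : \ell' \to \ell$: the point $f(x)$ is where the tangent plane at $x$
  meets $\ell'$.  A point of $S$ off both lines is the third point of $S$ on the line joining some
  $x$ and $y$, unless this line lies on $S$, i.e. $y = f(x)$ and $x = g(y)$; such points are reached
  through the residual conics, because $S$ is nonsingular there.  So it is enough to generate
  the rational points of $\ell$ and $\ell'$.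

  The plane through $\ell$ and $y$ cuts $S$ in $\ell$ and a conic which meets $\ell$ in the fibre
  $f^{-1}(y)$; chords and tangents of these conics turn generation into a combinatorial
  closure process for $f$ and $g$ on two sets of four points.  The rational fibres of a map of degree two
  have type $(2,1,1)$ or $(2,2)$.  A rational Eckardt point of $\ell$ is a ramification point $p$
  with $g(f(p)) = p$.  Hence in type $(2,1,1)$ one of the two ramification points is not an
  Eckardt point, and it generates all of $\ell$.  Pursuing the process leaves two configurations in
  which it stalls; there the cubic is determined up to signs by the values of $f$ and $g$, and one further
  tangent construction suffices.
\<close>

subsection \<open>The field with three elements\<close>

lemma three_f3 [simp]: "(3::f3) = 0"
proof -
  have "(of_nat CARD(three) :: f3) = 0"
    by (rule of_nat_card_eq_0)
  thus ?thesis by (simp add: card_three)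
qed

lemma two_f3 [simp]: "(2::f3) = -1"
proof -
  have "(2::f3) + 1 = 0" by simp
  thus ?thesis by (simp only: add_eq_0_iff2)
qed

lemma one_neq_minus_one_f3 [simp]: "(1::f3) \<noteq> -1" "(-1::f3) \<noteq> 1"
proof -
  show "(1::f3) \<noteq> -1"
  proof
    assume "(1::f3) = -1"
    hence "(1::f3) + 1 = 0" by (metis add.left_inverse)
    thus False by simp
  qed
  thus "(-1::f3) \<noteq> 1" by metis
qed

lemma f3_cases: "(a::f3) = 0 \<or> a = 1 \<or> a = -1"
proof -
  have "card {0, 1, -1::f3} = CARD(f3)" by (simp add: card_three)
  hence "{0, 1, -1::f3} = UNIV"
    by (metis card_subset_eq finite_class.finite_UNIV subset_UNIV)
  thus ?thesis by auto
qed

lemma f3_sum3 [simp]: "(a::f3) + a = - a" "a + (a + b) = b - a" "- a - a = a"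
   "b - a - a = b + a" "b + a + a = b - a"
  using f3_cases[of a] by auto

lemma f3_self_uminus [simp]: "(a::f3) = - a \<longleftrightarrow> a = 0" "- a = a \<longleftrightarrow> a = 0"
  using f3_cases[of a] by auto

section \<open>Vectors of the plane over the field with three elements\<close>

type_synonym v2 = "f3 \<times> f3"

lemma v2_sum3 [simp]: "(x::v2) + x = - x" "- x - x = x" "y + x + x = y - x" "y - x - x = y + x"
  by (cases x; cases y; simp)+

lemma f3_norm [simp]: "(a::f3) * a = (if a = 0 then 0 else 1)"
  using f3_cases[of a] by auto

definition det2 :: "v2 \<Rightarrow> v2 \<Rightarrow> f3" where
  "det2 x y = fst x * snd y - snd x * fst y"

lemma v2_span:
  assumes "det2 x y \<noteq> 0"
  shows "v \<in> {0, x, -x, y, -y, x + y, x - y, - x + y, - x - y}"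
proof -
  obtain x0 x1 y0 y1 v0 v1 where xyv: "x = (x0, x1)" "y = (y0, y1)" "v = (v0, v1)"
    by (metis prod.collapse)
  \<comment> \<open>Cramer's rule: a nonzero \<open>d\<close> is its own inverse, so
    \<open>i\<close> and \<open>j\<close> are the coordinates of \<open>v\<close> in the basis
    \<open>x\<close>, \<open>y\<close>.\<close>
  define d i j where "d = det2 x y" and "i = d * det2 v y" and "j = d * det2 x v"
  have dd: "d * d = 1" using assms by (simp add: d_def)
  have "i * x0 + j * y0 = (d * d) * v0" "i * x1 + j * y1 = (d * d) * v1"
    unfolding i_def j_def d_def det2_def xyv by (simp_all add: algebra_simps del: f3_norm)
  hence "v0 = i * x0 + j * y0" "v1 = i * x1 + j * y1" using dd by simp_all
  thus ?thesis using f3_cases[of i] f3_cases[of j] unfolding xyv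
    by (elim disjE) (simp_all add: zero_prod_def)
qed

lemma det2_zero:
  assumes "det2 x y = 0" "x \<noteq> 0"
  shows "y = 0 \<or> y = x \<or> y = - x"
proof -
  obtain x0 x1 y0 y1 where xy: "x = (x0, x1)" "y = (y0, y1)"
    by (metis prod.collapse)
  show ?thesis using assms f3_cases[of x0] f3_cases[of x1] f3_cases[of y0] f3_cases[of y1]
    unfolding xy det2_def by (elim disjE) (simp_all add: zero_prod_def)
qed

lemma v2_sums:
  fixes x y :: v2
  shows "x + (x + y) = y - x" "x - (x + y) = - y" "x + (- x - y) = - y" "x - (- x - y) = y - x"
    "x + (y - x) = y" "x - (y - x) = - x - y" "x + (x - y) = - x - y" "x - (x - y) = y"
    "- x - (x + y) = x - y" "- x - (x - y) = x + y"
  by (cases x; cases y; simp)+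

text \<open>
  \<open>al\<close> and \<open>be\<close> are the two bihomogeneous parts of the cubic.  Over \<open>f3\<close> the parallelogram law
  with $2 = -1$ characterizes quadratic forms.
\<close>

locale skew_cubic =
  fixes al be :: "v2 \<Rightarrow> v2 \<Rightarrow> f3"
  assumes al_add: "al x (y + z) = al x y + al x z"
    and al_quad: "al (x + z) y + al (x - z) y = - al x y - al z y"
    and be_add: "be (x + z) y = be x y + be z y"
    and be_quad: "be x (y + z) + be x (y - z) = - be x y - be x z"
begin

definition F :: "v2 \<Rightarrow> v2 \<Rightarrow> f3" where "F x y = al x y + be x y"

lemma al_0 [simp]: "al x 0 = 0" "al 0 y = 0"
proof -
  show "al x 0 = 0" using al_add[of x 0 0] by simp
  show "al 0 y = 0" using al_quad[of 0 0 y] by simp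
qed

lemma be_0 [simp]: "be x 0 = 0" "be 0 y = 0"
proof -
  show "be 0 y = 0" using be_add[of 0 0 y] by simp
  show "be x 0 = 0" using be_quad[of x 0 0] by simp
qed

lemma al_minus [simp]: "al x (- y) = - al x y" "al (- x) y = al x y"
proof -
  have "al x y + al x (-y) = 0" using al_add[of x y "-y"] by simp
  thus "al x (- y) = - al x y" by (simp add: add_eq_0_iff)
  have "al x y + al (-x) y = - al x y" using al_quad[of 0 x y] by simp
  thus "al (- x) y = al x y" by (simp add: algebra_simps add_eq_0_iff)
qed

lemma be_minus [simp]: "be (- x) y = - be x y" "be x (- y) = be x y"
proof -
  have "be x y + be (-x) y = 0" using be_add[of x "-x" y] by simp
  thus "be (- x) y = - be x y" by (simp add: add_eq_0_iff)
  have "be x y + be x (-y) = - be x y" using be_quad[of x 0 y] by simp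
  thus "be x (- y) = be x y" by (simp add: algebra_simps add_eq_0_iff)
qed

lemma al_diff: "al x (y - z) = al x y - al x z"
  using al_add[of x y "- z"] by simp

lemma be_diff: "be (x - z) y = be x y - be z y"
  using be_add[of x "- z" y] by simp

lemma F_0 [simp]: "F x 0 = 0" "F 0 y = 0" by (simp_all add: F_def)

lemma F_minus: "F (- x) (- y) = - F x y" by (simp add: F_def)

text \<open>In characteristic three the left side is the derivative of the cubic at (x, y) in the
  direction (v, w): the terms of second order cancel and -2 = 1. The derivative is additive in the
  direction, and since \<open>F\<close> vanishes on both lines the two partial directions need no
  correction term.\<close>

lemma F_polar_add:
  "F (x - v) (y - w) - F (x + v) (y + w) - F v w =
     (F (x - v) y - F (x + v) y) + (F x (y - w) - F x (y + w))"
proof -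
  have al1: "al (x + v) w = - al x w - al v w - al (x - v) w" for v w
    using al_quad[of x v w] by (simp add: algebra_simps eq_diff_eq)
  have be1: "be v (y + w) = - be v y - be v w - be v (y - w)" for v w
    using be_quad[of v y w] by (simp add: algebra_simps eq_diff_eq)
  show ?thesis
    by (simp only: F_def al_add al_diff be_add be_diff al1[of v w] be1[of v w])
      (simp add: algebra_simps)
qed

end

text \<open>
  A line over \<open>f3\<close> has four points.  If $F$ vanishes at $P$ and $R$, then $F(sP + tR) = st(as + bt)$, so the two
  values $F(P \pm R)$ decide which intersection divisor occurs: $2P + R$ when they are equal and
  nonzero, $P + R + (P + R)$ when only the first one vanishes.
\<close>

locale closed_set = skew_cubic +
  fixes G :: "v2 \<Rightarrow> v2 \<Rightarrow> bool"
  assumes G_minus: "G x y \<Longrightarrow> G (- x) (- y)"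
    and G_tangent: "\<lbrakk>G x y; F x y = 0; F x' y' = 0; F (x + x') (y + y') = F (x - x') (y - y');
          F (x + x') (y + y') \<noteq> 0\<rbrakk> \<Longrightarrow> G x' y'"
    and G_chord: "\<lbrakk>G x y; G x' y'; F x y = 0; F x' y' = 0; F (x + x') (y + y') = 0;
          F (x - x') (y - y') \<noteq> 0\<rbrakk> \<Longrightarrow> G (x + x') (y + y')"
begin

text \<open>Where \<open>al x y\<close> vanishes, \<open>F\<close> takes the same value
  \<open>be x y\<close> at (x, y) and (x, -y), so the line joining the two points is tangent at the
  point on the first line.\<close>

lemma G_transversal_tangent:
  assumes "G x 0" "al x y = 0" "be x y \<noteq> 0"
  shows "G 0 y"
  using G_tangent[of x 0 0 y] assms by (simp add: F_def)

text \<open>The point (x, y) is the third intersection on the line joining x and y; this line is not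
  on the surface because \<open>F x (- y)\<close> equals \<open>al x y\<close>.\<close>

lemma G_transversal_chord:
  assumes "G x 0" "G 0 y" "F x y = 0" "al x y \<noteq> 0"
  shows "G x y"
proof -
  have "be x y = - al x y" using assms(3) by (simp add: F_def add_eq_0_iff)
  hence "F x (- y) = al x y" by (simp add: F_def)
  thus ?thesis using G_chord[of x 0 0 y] assms by simp
qed

text \<open>
  The conic residual to $\ell'$ in the plane through $x$ and $\ell'$ passes through $x$, $y$ and the point $R$ over
  $z$; it is reached from $y$ by a tangent, and $z$ then from $x$ and $R$ by a chord.  The last three
  assumptions say that $f(x)$ is not the second intersection of the conic with $\ell'$.
\<close>

lemma G_plane_conic:
  assumes x: "G x 0" and y: "G 0 y" and by0: "be x y = 0" and bz: "be x z \<noteq> 0"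
    and plus: "be x (z + y) = 0 \<Longrightarrow> al x (z + y) \<noteq> 0"
    and minus: "be x (z - y) = 0 \<Longrightarrow> al x (z - y) \<noteq> 0"
    and double: "be x (z + y) \<noteq> 0 \<Longrightarrow> be x (z - y) \<noteq> 0 \<Longrightarrow> al x y \<noteq> 0"
  shows "G 0 z"
proof (cases "al x z = 0")
  case True
  thus ?thesis using G_transversal_tangent x bz by blast
next
  case False
  define L Q where "L = al x z" and "Q = be x z"
  have bq: "be x (z + y) + be x (z - y) = - Q"
    using be_quad[of x z y] by0 by (simp add: Q_def)
  have L: "L = 1 \<or> L = -1" and Q: "Q = 1 \<or> Q = -1"
    using f3_cases[of L] f3_cases[of Q] False bz by (auto simp: L_def Q_def)
  \<comment> \<open>\<open>al\<close> is even and \<open>be\<close> odd in the first argument, so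
    one of the signs of \<open>x\<close> puts (r, z) on the surface.\<close>
  define r where "r = (if L = Q then - x else x)"
  have alr: "al r v = al x v" for v by (simp add: r_def)
  have ber: "be r v = (if L = Q then - be x v else be x v)" for v by (simp add: r_def)
  have LQ: "L \<noteq> Q \<longleftrightarrow> L = - Q" using L Q by auto
  have Fr: "F r z = 0" using LQ by (simp add: F_def alr ber flip: L_def Q_def)
  define u v m where "u = be x (z + y)" and "v = be x (z - y)" and "m = al x y"
  have uv: "v = - Q - u" using bq by (simp add: u_def v_def algebra_simps eq_diff_eq)
  have Fp: "F r (z + y) = L + m + (if L = Q then - u else u)"
    and Fm: "F r (z - y) = L - m + (if L = Q then - v else v)"
    by (simp_all add: F_def alr ber al_add al_diff L_def m_def u_def v_def)
  \<comment> \<open>Since \<open>F\<close> is odd, opposite values mean that the line through (0, y)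
    and (r, z) is tangent at (0, y).\<close>
  have sumF: "F r (z - y) = - F r (z + y)"
    unfolding Fp Fm uv using LQ L Q f3_cases[of u] f3_cases[of m]
    by (elim disjE) simp_all
  have "u = 0 \<Longrightarrow> L + m \<noteq> 0" "v = 0 \<Longrightarrow> L - m \<noteq> 0" "u \<noteq> 0 \<Longrightarrow> v \<noteq> 0 \<Longrightarrow> m \<noteq> 0"
    using plus minus double by (auto simp: u_def v_def m_def L_def al_add al_diff)
  hence neq: "F r (z + y) \<noteq> 0"
    unfolding Fp uv using L Q f3_cases[of u] f3_cases[of m]
    by (elim disjE) simp_all
  have "G r 0" using x G_minus[of x 0] by (simp add: r_def)
  have "F (0 - r) (y - z) = F r (z + y)"
    using F_minus[of r "z - y"] sumF by simp
  hence "G r z"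
    using G_tangent[of 0 y r z] y Fr neq by (simp add: add.commute)
  moreover have "F (r + r) z \<noteq> 0"
    using Fr False bz by (auto simp: F_def alr ber)
  ultimately show ?thesis
    using G_chord[of r z "- r" 0] \<open>G r 0\<close> G_minus[of r 0] Fr by simp
qed

text \<open>The plane spanned by the first line and y cuts the surface in that line, the transversal
  joining x and y, and a third line; \<open>ns\<close> says that (x, y) lies on the transversal
  only. Points of the third line are chord points, and a chord from one of them to the first line
  passes through (x, y).\<close>

lemma G_on_transversal:
  assumes Gx: "\<And>v. v \<noteq> 0 \<Longrightarrow> G v 0" and Gy: "\<And>v. v \<noteq> 0 \<Longrightarrow> G 0 v"
    and "x \<noteq> 0" "y \<noteq> 0" and al0: "al x y = 0" and be0: "be x y = 0"
    and al_ne: "al t y \<noteq> 0" and be_ne: "be w y \<noteq> 0"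
    and ns: "F (x - v) y \<noteq> F (x + v) y"
  shows "G x y"
proof -
  have det: "det2 x v \<noteq> 0"
  proof
    assume "det2 x v = 0"
    hence "v = 0 \<or> v = x \<or> v = - x" using \<open>x \<noteq> 0\<close> by (rule det2_zero)
    thus False using ns al0 be0 by (auto simp: F_def)
  qed
  define Q A b where "Q = al v y" and "A = al (x + v) y" and "b = be v y"
  have A': "al (x - v) y = - Q - A" "al (v - x) y = - Q - A" "al (- v - x) y = A" "al (- x - v) y = A"
  proof -
    show "al (x - v) y = - Q - A"
      using al_quad[of x v y] al0 by (simp add: Q_def A_def algebra_simps eq_diff_eq)
    thus "al (v - x) y = - Q - A" using al_minus(2)[of "x - v" y] by simp
    have "- v - x = - (x + v)" "- x - v = - (x + v)" by simp_all
    thus "al (- v - x) y = A" "al (- x - v) y = A" by (simp_all only: al_minus A_def)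
  qed
  have be_ne: "b \<noteq> 0" using v2_span[OF det, of w] be_ne be0
    by (auto simp: b_def be_add be_diff)
  have al_ne: "Q \<noteq> 0 \<or> A \<noteq> 0" using v2_span[OF det, of t] al_ne al0 A'
    by (auto simp: Q_def A_def add.commute)
  have step: "G x y" if "F (x + u) y = 0" "al (x + u) y \<noteq> 0" "F (x - u) y \<noteq> 0" for u
  proof -
    have "x + u \<noteq> 0" "u \<noteq> 0" using that al0 be0 by (auto simp: F_def)
    hence "G (x + u) y" "G (- u) 0"
      using G_transversal_chord[of "x + u" y] Gx Gy \<open>y \<noteq> 0\<close> that by auto
    thus ?thesis using G_chord[of "x + u" y "- u" 0] that al0 be0
      by (simp add: F_def add.assoc)
  qed
  \<comment> \<open>This is the derivative at (x, y) in the direction v. Its being nonzero ensures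
    that one of the six choices of \<open>u\<close> below fits \<open>step\<close>.\<close>
  have "A - Q + b \<noteq> 0" using ns A' be0 f3_cases[of Q] f3_cases[of A] f3_cases[of b]
    by (elim disjE) (simp_all add: F_def be_add be_diff flip: Q_def A_def b_def)
  show ?thesis
    using step[of v] step[of "- v"] step[of "x + v"] step[of "- x - v"] step[of "v - x"] step[of "x - v"]
      be_ne al_ne \<open>A - Q + b \<noteq> 0\<close> f3_cases[of Q] f3_cases[of A] f3_cases[of b] A' be0
    by (elim disjE) (simp_all add: F_def be_add be_diff v2_sums flip: Q_def A_def b_def)
qed

text \<open>The pattern of zeros fixes \<open>al\<close> and \<open>be\<close> up to the two signs
  \<open>s\<close> and \<open>r\<close>. A tangent at x0 + x1 reaches a point (x, y0 + y1) off both
  lines, with x = x1 or x = -x1, and a tangent at that point reaches y0.\<close>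

lemma G_exceptional_split:
  assumes al: "al x0 y0 = 0" "al x1 y1 = 0" "al (x0 + x1) (y0 + y1) = 0" "al (x0 - x1) (y0 + y1) = 0"
    and al_ne: "al x1 y0 \<noteq> 0" "al (x0 + x1) y0 \<noteq> 0" "al (x0 - x1) y0 \<noteq> 0" "al x0 y1 \<noteq> 0"
    and be: "be x0 y0 = 0" "be x0 y1 = 0" "be (x0 + x1) (y0 + y1) = 0" "be (x0 - x1) (y0 - y1) = 0"
    and be_ne: "be x1 y0 \<noteq> 0" "be x1 y1 \<noteq> 0" "be x0 (y0 + y1) \<noteq> 0"
    and G: "G (x0 + x1) 0"
  shows "G 0 y0"
proof -
  define s r where "s = al x1 y0" and "r = be x0 (y0 + y1)"
  \<comment> \<open>The parallelogram law gives three nonzero values with sum zero, and over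
    \<open>f3\<close> such values are equal.\<close>
  have p0: "al (x0 + x1) y0 = s" "al (x0 - x1) y0 = s"
    using al_quad[of x0 x1 y0] al al_ne f3_cases[of s] f3_cases[of "al (x0 + x1) y0"] f3_cases[of "al (x0 - x1) y0"]
    by (auto simp flip: s_def)
  have pm: "al (x0 + x1) y1 = - s" "al (x0 - x1) y1 = - s"
    using al p0 by (simp_all add: al_add add_eq_0_iff)
  have "al x0 y1 = - s" using pm al_quad[of x0 x1 y1] al
     f3_cases[of s] f3_cases[of "al x0 y1"] by auto
  have rm: "be x0 (y0 - y1) = - r" using be_quad[of x0 y0 y1] be by (simp add: r_def add_eq_0_iff)
  have b1: "be x1 (y0 + y1) = - r" "be x1 (y0 - y1) = - r"
    using be rm by (simp_all add: be_add be_diff r_def add_eq_0_iff)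
  have "s \<noteq> 0" "r \<noteq> 0" using al_ne be_ne by (simp_all add: s_def r_def)
  have b2: "be x1 y0 = r" "be x1 y1 = r"
    using be_quad[of x1 y0 y1] b1 be_ne(1,2) \<open>r \<noteq> 0\<close>
      f3_cases[of r] f3_cases[of "be x1 y0"] f3_cases[of "be x1 y1"]
    by auto
  have sr: "s = 1 \<or> s = -1" "r = 1 \<or> r = -1"
    using \<open>s \<noteq> 0\<close> \<open>r \<noteq> 0\<close> f3_cases[of s] f3_cases[of r] by blast+
  \<comment> \<open>The sign of \<open>x1\<close> is the one that puts (x, y0 + y1) on the
    surface.\<close>
  define x where "x = (if s = r then x1 else - x1)"
  have alx: "al x v = al x1 v" for v by (simp add: x_def)
  have bex: "be x v = (if s = r then be x1 v else - be x1 v)" for v by (simp add: x_def)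
  have FR: "F x (y0 + y1) = 0"
    using sr by (auto simp: F_def alx bex al_add b1 al simp flip: s_def)
  have cases: "(s = r \<and> x = x1) \<or> (s = - r \<and> x = - x1)"
    using sr by (auto simp: x_def)
  note vals = al be p0 pm rm b1 b2 \<open>al x0 y1 = - s\<close> s_def[symmetric] r_def[symmetric]
  have "G x (y0 + y1)"
  proof (rule G_tangent[OF G _ FR])
    have "F (x0 - x1) (y0 + y1) = - r" "F x0 (y0 + y1) = - s + r"
      "F x0 (- (y0 + y1)) = s + r" "F (x0 - x1) (- (y0 + y1)) = - r"
      by (simp_all add: F_def al_add be_diff vals del: minus_add_distrib)
    hence "F (x0 + x1 + x) (0 + (y0 + y1)) = - r \<and> F (x0 + x1 - x) (0 - (y0 + y1)) = - r"
      using cases by (elim disjE) (simp_all del: minus_add_distrib)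
    thus "F (x0 + x1 + x) (0 + (y0 + y1)) = F (x0 + x1 - x) (0 - (y0 + y1))"
      "F (x0 + x1 + x) (0 + (y0 + y1)) \<noteq> 0" using \<open>r \<noteq> 0\<close> by simp_all
  qed simp
  thus ?thesis
  proof (rule G_tangent[OF _ FR])
    have "F x1 (y1 - y0) = - s - r" "F x1 y1 = r" "F (- x1) (y1 - y0) = - s + r" "F (- x1) y1 = - r"
      using be_quad[of x1 y1 y0] by (simp_all add: F_def al_diff vals add.commute)
    moreover have sums: "y0 + y1 + y0 = y1 - y0"
      by (simp add: v2_sums add.commute add.left_commute)
    ultimately have "F (x + 0) (y0 + y1 + y0) = s \<and> F (x - 0) (y0 + y1 - y0) = s"
      using cases by (elim disjE) (simp_all add: sums)
    thus "F (x + 0) (y0 + y1 + y0) = F (x - 0) (y0 + y1 - y0)"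
      "F (x + 0) (y0 + y1 + y0) \<noteq> 0"  using \<open>s \<noteq> 0\<close> by simp_all
  qed simp
qed

text \<open>The zeros fix \<open>al\<close> and \<open>be\<close> up to four signs. Nonsingularity
  at the points (p, a) and (p, -a) of a transversal contained in the surface excludes one relation
  between the signs; after that a tangent at p + q reaches one of these points, and tangents there
  reach b and a - b.\<close>

lemma G_exceptional_nonsplit:
  assumes al: "al p a = 0" "al (p + q) a = 0" "al q b = 0" "al (p - q) b = 0"
    and al_ne: "al q a \<noteq> 0" "al p b \<noteq> 0"
    and be: "be p a = 0" "be p (a + b) = 0" "be q b = 0" "be q (a - b) = 0"
    and be_ne: "be p b \<noteq> 0" "be q a \<noteq> 0"
    and det: "det2 p q \<noteq> 0" "det2 a b \<noteq> 0"
    and ns: "\<And>c. c = a \<or> c = - a \<Longrightarrow> \<exists>v w. F (p - v) (c - w) - F (p + v) (c + w) \<noteq> F v w"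
    and G: "G (p + q) 0"
  shows "G 0 a \<and> G 0 b \<and> G 0 (a - b)"
proof -
  define s1 s2 s3 s4 where "s1 = al q a" and "s2 = al p b" and "s3 = be p b" and "s4 = be q a"
  have ne: "s1 = 1 \<or> s1 = -1" "s2 = 1 \<or> s2 = -1" "s3 = 1 \<or> s3 = -1" "s4 = 1 \<or> s4 = -1"
    using al_ne be_ne f3_cases[of s1] f3_cases[of s2] f3_cases[of s3] f3_cases[of s4]
    by (simp_all add: s1_def s2_def s3_def s4_def)
  have vals: "al (p - q) a = - s1" "al (p + q) b = - s2" "be p (a - b) = - s3" "be q (a + b) = - s4"
    using al_quad[of p q a] al_quad[of p q b] be_quad[of p a b] be_quad[of q a b] al be
    by (simp_all add: s1_def s2_def s3_def s4_def)
  have vals': "al (q - p) a = - s1" "al (q - p) b = 0" "al (- p - q) a = 0" "al (- p - q) b = - s2"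
    "be p (b - a) = - s3" "be q (b - a) = 0" "be p (- a - b) = 0" "be q (- a - b) = - s4"
    "be p (b + a) = 0" "be q (b + a) = - s4"
    using al_minus(2)[of "p - q"] al_minus(2)[of "p + q"] be_minus(2)[of _ "a - b"] be_minus(2)[of _ "a + b"]
      vals al be by (simp_all add: add.commute)
  note defs = s1_def[symmetric] s2_def[symmetric] s3_def[symmetric] s4_def[symmetric]
  \<comment> \<open>With this sign the derivative of \<open>F\<close> at (p, c) vanishes in the
    directions of the first line, so only the second line can detect nonsingularity.\<close>
  define c where "c = (if s4 = s1 then a else - a)"
  have s4: "s4 = (if s4 = s1 then s1 else - s1)" using ne by auto
  \<comment> \<open>Equality would make the derivative at (p, c) vanish along the second line too,
    contrary to \<open>ns\<close>.\<close>
  have "s3 \<noteq> (if s4 = s1 then s2 else - s2)"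
  proof
    assume s3: "s3 = (if s4 = s1 then s2 else - s2)"
    have "F (p - v) c = F (p + v) c" for v
    proof (cases "s4 = s1")
      case True
      thus ?thesis using v2_span[OF det(1), of v]
        by (elim insertE emptyE) (simp_all add: F_def c_def be_add be_diff v2_sums al be vals vals' defs)
    next
      case False
      hence "s4 = - s1" using s4 by simp
      with False show ?thesis using v2_span[OF det(1), of v]
        by (elim insertE emptyE) (simp_all add: F_def c_def be_add be_diff v2_sums al be vals vals' defs)
    qed
    moreover have "F p (c - w) = F p (c + w)" for w
    proof (cases "s4 = s1")
      case True
      hence "s3 = s2" using s3 by simp
      with True show ?thesis using v2_span[OF det(2), of w]
        by (elim insertE emptyE) (simp_all add: F_def c_def al_add al_diff v2_sums al be vals vals' defs)
    next
      case False
      hence "s3 = - s2" using s3 by simp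
      with False show ?thesis using v2_span[OF det(2), of w]
        by (elim insertE emptyE) (simp_all add: F_def c_def al_add al_diff v2_sums al be vals vals' defs)
    qed
    ultimately have "F (p - v) (c - w) - F (p + v) (c + w) = F v w" for v w
      using F_polar_add[of p v c w] by simp
    moreover have "c = a \<or> c = - a" by (simp add: c_def)
    ultimately show False using ns[of c] by blast
  qed
  hence s3: "s3 = (if s4 = s1 then - s2 else s2)" using ne by auto
  have c: "(c = a \<and> s4 = s1 \<and> s3 = - s2) \<or> (c = - a \<and> s4 = - s1 \<and> s3 = s2)"
    using s3 s4 by (simp add: c_def split: if_splits)
  note rules = F_def al_add al_diff be_add be_diff v2_sums al be vals vals' defs
  have Fpc: "F p (- c) = 0" using c by (elim disjE) (simp_all add: F_def al be)
  have M: "G p (- c)"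
  proof (rule G_tangent[OF G _ Fpc])
    have "F (q - p) (- c) = F q c" "F q c \<noteq> 0"
      using c ne(1) by (elim disjE; simp add: rules)+
    moreover have sums: "p + q + p = q - p" by (simp add: v2_sums add.commute add.left_commute)
    ultimately show "F (p + q + p) (0 + - c) = F (p + q - p) (0 - - c)" "F (p + q + p) (0 + - c) \<noteq> 0"
      by (simp_all add: sums)
  qed simp
  \<comment> \<open>At the other point (p, -c) the derivative vanishes along the second line, so
    lines from there to b and to a - b are tangents.\<close>
  have "F p (- c + b) = F p (- c - b)" "F p (- c + b) \<noteq> 0"
    using c ne(2) by (elim disjE; simp add: rules)+
  hence "G 0 b" using G_tangent[OF M Fpc, of 0 b] by simp
  moreover have "F p (- c + (a - b)) = F p (- c - (a - b))" "F p (- c + (a - b)) \<noteq> 0"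
    using c ne(2) by (elim disjE; simp add: rules)+
  hence "G 0 (a - b)" using G_tangent[OF M Fpc, of 0 "a - b"] by simp
  moreover have "G 0 a"
    using G_transversal_tangent G al be be_ne by (simp add: be_add)
  ultimately show ?thesis by blast
qed

end

subsection \<open>Combinatorics of two maps between four-point lines\<close>

datatype pt = P0 | P1 | P2 | P3

lemma UNIV_pt: "UNIV = {P0, P1, P2, P3}"
  using pt.exhaust by auto

lemma card_pt: "CARD(pt) = 4"
  by (simp add: UNIV_pt)

lemma pt_exhaust4:
  assumes "distinct [a, b, c, d :: pt]"
  shows "x = a \<or> x = b \<or> x = c \<or> x = d"
proof -
  have "finite (UNIV :: pt set)" by (simp add: UNIV_pt)
  moreover have "card {a, b, c, d} = CARD(pt)" using assms by (simp add: card_pt)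
  ultimately have "UNIV = {a, b, c, d}" by (metis card_subset_eq subset_UNIV)
  thus ?thesis by blast
qed

lemma pt_extend:
  assumes "a \<noteq> b"
  obtains c d where "distinct [a, b, c, d :: pt]"
proof -
  have "\<exists>c d. distinct [a, b, c, d]"
    using assms by (cases a; cases b) (simp_all, (metis pt.distinct)+)
  thus ?thesis using that by blast
qed

lemma pt_extend1:
  assumes "distinct [a, b, c :: pt]"
  obtains d where "distinct [a, b, c, d]"
proof -
  obtain d e where "distinct [a, b, d, e]" using assms pt_extend[of a b] by auto
  moreover from this have "c = d \<or> c = e" using assms pt_exhaust4[of a b d e c] by auto
  ultimately show ?thesis using that[of d] that[of e] by auto
qed

definition two_to_one :: "(pt \<Rightarrow> pt) \<Rightarrow> bool" where
  "two_to_one f \<longleftrightarrow> \<not> inj f \<and> (\<forall>p q r. f p = f q \<longrightarrow> f q = f r \<longrightarrow> p = q \<or> q = r \<or> p = r)"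

text \<open>In a fibre of degree two the conjugate of a rational point is rational, so a single
  rational point is a double one. Ramification can therefore be read off the rational
  points.\<close>

definition ramified :: "(pt \<Rightarrow> pt) \<Rightarrow> pt \<Rightarrow> bool" where
  "ramified f p \<longleftrightarrow> (\<forall>r. f r = f p \<longrightarrow> r = p)"

text \<open>The second point of the fibre, counted with multiplicity.\<close>

definition conjugate :: "(pt \<Rightarrow> pt) \<Rightarrow> pt \<Rightarrow> pt \<Rightarrow> bool" where
  "conjugate f p q \<longleftrightarrow> f q = f p \<and> (q \<noteq> p \<or> ramified f p)"

definition unique_eckardt :: "(pt \<Rightarrow> pt) \<Rightarrow> (pt \<Rightarrow> pt) \<Rightarrow> bool" where
  "unique_eckardt f g \<longleftrightarrow>
     (\<forall>p q. ramified f p \<longrightarrow> g (f p) = p \<longrightarrow> ramified f q \<longrightarrow> g (f q) = q \<longrightarrow> p = q)"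

text \<open>
  \<open>A\<close> and \<open>B\<close> stand for the points of $\ell$ and $\ell'$ already generated.  The first two
  clauses come from lines joining the two, the last two from the residual conics.
\<close>

definition closed_pair :: "(pt \<Rightarrow> pt) \<Rightarrow> (pt \<Rightarrow> pt) \<Rightarrow> pt set \<Rightarrow> pt set \<Rightarrow> bool" where
  "closed_pair f g A B \<longleftrightarrow>
     (\<forall>p\<in>A. g (f p) \<noteq> p \<longrightarrow> f p \<in> B) \<and>
     (\<forall>q\<in>B. f (g q) \<noteq> q \<longrightarrow> g q \<in> A) \<and>
     (\<forall>q r. q \<in> B \<longrightarrow> g q \<in> A \<longrightarrow> \<not> conjugate g q (f (g q)) \<longrightarrow> \<not> conjugate g q r \<longrightarrow> r \<in> B) \<and>
     (\<forall>p r. p \<in> A \<longrightarrow> f p \<in> B \<longrightarrow> \<not> conjugate f p (g (f p)) \<longrightarrow> \<not> conjugate f p r \<longrightarrow> r \<in> A)"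

lemma two_to_one_shape:
  assumes "two_to_one f"
  obtains (split) p q r s where "distinct [p, q, r, s]" "f r = f s" "distinct [f p, f q, f r]"
  | (nonsplit) p q r s where "distinct [p, q, r, s]" "f p = f q" "f r = f s" "f p \<noteq> f r"
proof -
  obtain r s where rs: "r \<noteq> s" "f r = f s"
    using assms by (auto simp: two_to_one_def inj_def)
  then obtain p q where d: "distinct [r, s, p, q]" using pt_extend by metis
  have "f p \<noteq> f r" "f q \<noteq> f r" using assms rs d unfolding two_to_one_def
    by (metis distinct_length_2_or_more)+
  thus ?thesis using that(1)[of p q r s] that(2)[of p q r s] d rs by (cases "f p = f q") auto
qed

text \<open>A ramification point is conjugate only to itself, so the last clause of
  \<open>closed_pair\<close> applies to p and reaches every other point.\<close>

lemma closed_pair_ramified: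
  assumes "closed_pair f g A B" "p \<in> A" "ramified f p" "g (f p) \<noteq> p"
  shows "A = UNIV" "f p \<in> B"
proof -
  show "f p \<in> B" using assms unfolding closed_pair_def by blast
  moreover have "\<not> conjugate f p r" if "r \<noteq> p" for r
    using assms(3) that by (auto simp: conjugate_def ramified_def)
  ultimately have "r \<in> A" for r
    using assms unfolding closed_pair_def by metis
  thus "A = UNIV" by blast
qed

text \<open>A missing point must be the conjugate of y. The other two points z and t then lie in B
  and could reach it unless \<open>f (g z)\<close> and \<open>f (g t)\<close> are conjugate to z and
  t. If z and t share a fibre this is contradictory; otherwise both are ramified and fixed by f
  after g, against uniqueness.\<close>

lemma closed_pair_full:
  assumes c: "closed_pair f g UNIV B" and g: "two_to_one g"
    and eck: "unique_eckardt g f"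
    and y: "y \<in> B" "\<not> conjugate g y (f (g y))"
  shows "B = UNIV"
proof (rule ccontr)
  assume "B \<noteq> UNIV"
  have step: "r \<in> B" if "q \<in> B" "\<not> conjugate g q (f (g q))" "\<not> conjugate g q r" for q r
    using c that unfolding closed_pair_def by blast
  obtain y' where y': "y' \<notin> B" using \<open>B \<noteq> UNIV\<close> by blast
  hence yc: "conjugate g y y'" using step y by blast
  have "y' \<noteq> y" using y y' by blast
  then obtain z t where d: "distinct [y, y', z, t]" using pt_extend by metis
  have nz: "g z \<noteq> g y" "g t \<noteq> g y"
    using g yc d unfolding two_to_one_def conjugate_def
    by (metis distinct_length_2_or_more)+
  hence "z \<in> B" "t \<in> B" using step y unfolding conjugate_def by metis+
  have "\<not> conjugate g z y'" "\<not> conjugate g t y'" using nz yc by (auto simp: conjugate_def)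
  hence zt: "conjugate g z (f (g z))" "conjugate g t (f (g t))"
    using step \<open>z \<in> B\<close> \<open>t \<in> B\<close> y' by blast+
  have U: "x = y \<or> x = y' \<or> x = z \<or> x = t" for x using pt_exhaust4[OF d] .
  show False
  proof (cases "g z = g t")
    case True
    hence "\<not> ramified g z" "\<not> ramified g t" using d by (auto simp: ramified_def)
    hence "f (g z) \<noteq> z" "f (g t) \<noteq> t" using zt by (auto simp: conjugate_def)
    thus False using U[of "f (g z)"] zt nz yc True by (auto simp: conjugate_def)
  next
    case False
    have "ramified g z" "ramified g t"
      unfolding ramified_def using U nz False yc by (metis conjugate_def)+
    moreover from this have "f (g z) = z" "f (g t) = t" using zt by (auto simp: conjugate_def ramified_def)
    ultimately show False using eck d unfolding unique_eckardt_def by auto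
  qed
qed

lemma split_ramified:
  assumes "distinct [p, q, r, s]" "f r = f s" "distinct [f p, f q, f r]"
  shows "ramified f p" "ramified f q"
  unfolding ramified_def
proof safe
  fix x
  show "x = p" if "f x = f p" using pt_exhaust4[OF assms(1), of x] assms(2,3) that by auto
  show "x = q" if "f x = f q" using pt_exhaust4[OF assms(1), of x] assms(2,3) that by auto
qed

text \<open>The ramified point p fills A. If B is not full, \<open>closed_pair_full\<close> makes
  \<open>f (g y)\<close> conjugate to y for each y in B; applied to \<open>f p\<close> and
  \<open>f r\<close> this yields the stated values of g.\<close>

lemma closed_pair_split:
  assumes d: "distinct [p, q, r, s]" and rs: "f r = f s" and fd: "distinct [f p, f q, f r]"
    and good: "g (f p) \<noteq> p" and g: "two_to_one g"
    and eck: "unique_eckardt g f"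
    and c: "closed_pair f g A B" and "p \<in> A"
  shows "A = UNIV" "f p \<in> B" "f r \<in> B"
    "B \<noteq> UNIV \<Longrightarrow> g (f p) = q \<and> g (f q) = q \<and> ramified g (f r) \<and> f (g (f r)) = f r"
proof -
  have U: "x = p \<or> x = q \<or> x = r \<or> x = s" for x using pt_exhaust4[OF d] .
  have im: "f x = f p \<or> f x = f q \<or> f x = f r" for x using U[of x] rs by auto
  have ramp: "ramified f p" using split_ramified(1)[OF d rs fd] .
  show "A = UNIV" "f p \<in> B"
    using closed_pair_ramified[OF c \<open>p \<in> A\<close> ramp good] by auto
  have c': "closed_pair f g UNIV B" using c \<open>A = UNIV\<close> by simp
  \<comment> \<open>r and s have the same image, and g cannot send it back to both, so one of them
    gives a tangent transversal.\<close>
  have "g (f r) \<noteq> r \<or> g (f s) \<noteq> s" using rs d by auto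
  thus "f r \<in> B" using c' rs unfolding closed_pair_def by (metis UNIV_I)
  assume "B \<noteq> UNIV"
  hence conj: "conjugate g y (f (g y))" if "y \<in> B" for y
    using closed_pair_full[OF c' g eck] that by blast
  note fp = conj[OF \<open>f p \<in> B\<close>] and fr = conj[OF \<open>f r \<in> B\<close>]
  have g3: "x = y \<or> y = z \<or> x = z" if "g x = g y" "g y = g z" for x y z
    using g that unfolding two_to_one_def by blast
  have "f (g (f p)) \<noteq> f p" using good ramp unfolding ramified_def by blast
  moreover have "f (g (f p)) \<noteq> f r"
  proof
    assume e: "f (g (f p)) = f r"
    hence "g (f r) = g (f p)" using fp by (simp add: conjugate_def)
    moreover have "\<not> ramified g (f r)" using \<open>g (f r) = g (f p)\<close> fd by (auto simp: ramified_def)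
    ultimately show False using fr e by (simp add: conjugate_def)
  qed
  ultimately have fq: "f (g (f p)) = f q" using im by metis
  hence gq: "g (f q) = g (f p)" using fp by (simp add: conjugate_def)
  define t where "t = g (f p)"
  have "g (f p) = q" using fq[folded t_def] U[of t] fd rs unfolding t_def[symmetric] by auto
  moreover have fr': "f (g (f r)) = f r"
  proof (rule ccontr)
    assume "f (g (f r)) \<noteq> f r"
    hence "f (g (f r)) = f p \<or> f (g (f r)) = f q" using im by metis
    moreover have "g (f (g (f r))) = g (f r)" using fr by (simp only: conjugate_def)
    ultimately have "g (f r) = g (f p)" using gq by (elim disjE) simp_all
    from g3[OF this gq[symmetric]] show False using fd by auto
  qed
  moreover have "ramified g (f r)" using fr fr' by (simp add: conjugate_def)
  ultimately show "g (f p) = q \<and> g (f q) = q \<and> ramified g (f r) \<and> f (g (f r)) = f r"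
    using gq by simp
qed

definition generates :: "(pt \<Rightarrow> pt) \<Rightarrow> (pt \<Rightarrow> pt) \<Rightarrow> pt \<Rightarrow> bool" where
  "generates f g p \<longleftrightarrow> (\<forall>A B. closed_pair f g A B \<longrightarrow> p \<in> A \<longrightarrow> A = UNIV \<and> B = UNIV)"

text \<open>The first configuration in which closure stalls: only y0 is still to be supplied. The
  numbering follows \<open>G_exceptional_split\<close>, with p0, p1, p2, p3 the directions of x0,
  x1, x0 + x1, x0 - x1, and likewise for y0, y1, y2, y3.\<close>

definition exceptional_split where
  "exceptional_split f g p0 p1 p2 p3 y0 y1 y2 y3 \<longleftrightarrow>
     distinct [p0, p1, p2, p3 :: pt] \<and> distinct [y0, y1, y2, y3 :: pt] \<and>
     f p0 = y0 \<and> f p1 = y1 \<and> f p2 = y2 \<and> f p3 = y2 \<and>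
     g y0 = p0 \<and> g y1 = p0 \<and> g y2 = p2 \<and> g y3 = p3 \<and>
     (\<forall>A B. closed_pair f g A B \<longrightarrow> p1 \<in> A \<longrightarrow> A = UNIV \<and> (y0 \<in> B \<longrightarrow> B = UNIV))"

definition exceptional_nonsplit where
  "exceptional_nonsplit f g p p' q q' y y' z z' \<longleftrightarrow>
     distinct [p, p', q, q' :: pt] \<and> distinct [y, y', z, z' :: pt] \<and>
     f p = y \<and> f p' = y \<and> f q = z \<and> f q' = z \<and>
     g y = p \<and> g y' = p \<and> g z = q \<and> g z' = q \<and>
     (\<forall>A B. closed_pair f g A B \<longrightarrow> p' \<in> A \<longrightarrow> y \<in> B \<longrightarrow> z \<in> B \<longrightarrow> z' \<in> B \<longrightarrow> A = UNIV \<and> B = UNIV)"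

text \<open>If p stalls, g is constrained by \<open>closed_pair_split\<close>, and only its value at
  the point y outside the image of f remains. If it is the point u conjugate to t, the configuration
  is exceptional; if it is p, then y is a ramification point of g and generates everything.\<close>

lemma generation_split:
  assumes f: "two_to_one f" and g: "two_to_one g"
    and eckf: "unique_eckardt f g"
    and eckg: "unique_eckardt g f"
    and d: "distinct [p, q, r, s]" and rs: "f r = f s" and fd: "distinct [f p, f q, f r]"
    and good: "g (f p) \<noteq> p"
  shows "(\<exists>p. generates f g p) \<or> (\<exists>y. generates g f y) \<or>
     (\<exists>p0 p1 p2 p3 y0 y1 y2 y3. exceptional_split f g p0 p1 p2 p3 y0 y1 y2 y3)"
proof (cases "generates f g p")
  case False
  note cs = closed_pair_split[OF d rs fd good g eckg]
  obtain A B where AB: "closed_pair f g A B" "p \<in> A" "\<not> (A = UNIV \<and> B = UNIV)"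
    using False unfolding generates_def by metis
  hence "B \<noteq> UNIV" using cs(1)[OF AB(1,2)] by simp
  from cs(4)[OF AB(1,2) this]
  have pq: "g (f p) = q" "g (f q) = q" and r: "ramified g (f r)" "f (g (f r)) = f r" by simp_all
  have U: "x = p \<or> x = q \<or> x = r \<or> x = s" for x using pt_exhaust4[OF d] .
  have "distinct [f q, f p, f r]" using fd by auto
  then obtain y where yd: "distinct [f q, f p, f r, y]" by (rule pt_extend1)
  have UY: "x = f q \<or> x = f p \<or> x = f r \<or> x = y" for x using pt_exhaust4[OF yd] .
  define t u where "t = g (f r)" and "u = (if t = r then s else r)"
  have t: "t = r \<or> t = s" using r(2)[folded t_def] U[of t] fd by auto
  have tu: "distinct [q, p, t, u]" "f u = f r" "f t = f r"
    using t d rs by (auto simp: u_def)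
  have "g y \<noteq> q"
  proof
    assume "g y = q"
    hence "f p = f q \<or> f q = y \<or> f p = y" using g pq unfolding two_to_one_def by metis
    thus False using yd by auto
  qed
  moreover have "g y \<noteq> t" using r(1) yd unfolding ramified_def t_def by auto
  ultimately have "g y = p \<or> g y = u" using pt_exhaust4[OF tu(1), of "g y"] by simp
  thus ?thesis
  proof
    assume gy: "g y = u"
    have "B = UNIV" if c: "closed_pair f g UNIV B" and "f q \<in> B" for B
    proof (rule closed_pair_full[OF c g eckg \<open>f q \<in> B\<close>])
      show "\<not> conjugate g (f q) (f (g (f q)))" using pq fd by (auto simp: conjugate_def ramified_def)
    qed
    moreover have "A = UNIV" if "closed_pair f g A B" "p \<in> A" for A B using cs(1)[OF that] .
    ultimately have gen: "\<forall>A B. closed_pair f g A B \<longrightarrow> p \<in> A \<longrightarrow> A = UNIV \<and> (f q \<in> B \<longrightarrow> B = UNIV)"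
      by metis
    have "exceptional_split f g q p t u (f q) (f p) (f r) y"
      unfolding exceptional_split_def
      by (intro conjI gen tu yd pq gy refl) (simp add: t_def)
    thus ?thesis by (intro disjI2 exI)
  next
    assume gy: "g y = p"
    have uniq: "x = y" if "g x = p" for x
    proof -
      have "g (f r) \<noteq> p" using tu(1) unfolding t_def[symmetric] by auto
      hence "x \<noteq> f q" "x \<noteq> f p" "x \<noteq> f r" using pq d that by auto
      thus ?thesis using UY[of x] by simp
    qed
    have "ramified g y" unfolding ramified_def gy using uniq by metis
    have "A = UNIV \<and> B = UNIV" if c: "closed_pair g f B A" and "y \<in> B" for A B
    proof -
      have "f (g y) \<noteq> y" using gy yd by auto
      note yr = closed_pair_ramified[OF c \<open>y \<in> B\<close> \<open>ramified g y\<close> this]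
      have "p \<in> A" using yr gy by simp
      have "A = UNIV"
      proof (rule closed_pair_full[OF _ f eckf])
        show "closed_pair g f UNIV A" using c yr by simp
        show "p \<in> A" by fact
        have "ramified f p" using split_ramified(1)[OF d rs fd] .
        thus "\<not> conjugate f p (g (f p))" using pq d by (auto simp: conjugate_def ramified_def)
      qed
      thus ?thesis using yr by simp
    qed
    hence "generates g f y" unfolding generates_def by metis
    thus ?thesis by (intro disjI2 disjI1 exI)
  qed
qed blast

lemma nonsplit_conjugate:
  assumes "distinct [p, p', q, q']" "f p = f p'" "f q = f q'" "f p \<noteq> f q"
  shows "conjugate f x w \<longleftrightarrow> f w = f x \<and> w \<noteq> x" "\<exists>w. f w = f x \<and> w \<noteq> x"
proof -
  have U: "x = p \<or> x = p' \<or> x = q \<or> x = q'" for x using pt_exhaust4 assms(1) .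
  show "\<exists>w. f w = f x \<and> w \<noteq> x"
    using assms U[of x] by auto
  thus "conjugate f x w \<longleftrightarrow> f w = f x \<and> w \<noteq> x"
    by (auto simp: conjugate_def ramified_def)
qed

text \<open>Since f after g moves \<open>f p\<close>, closure yields in turn \<open>f p\<close>,
  then q and q', then \<open>f q\<close>. Now B contains the image of f and A lacks at most p'; the
  rest depends on whether g identifies the two values of f.\<close>

lemma generation_nonsplit:
  assumes d: "distinct [p, p', q, q']" and fp: "f p = f p'" "f q = f q'" "f p \<noteq> f q"
    and h: "distinct [y, y', z, z']" "g y = g y'" "g z = g z'" "g y \<noteq> g z"
    and g: "two_to_one g"
    and good: "f (g (f p)) \<noteq> f p"
  shows "generates f g p"
  unfolding generates_def
proof (intro allI impI)
  fix A B assume c: "closed_pair f g A B" and "p \<in> A"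
  have U: "x = p \<or> x = p' \<or> x = q \<or> x = q'" for x using pt_exhaust4 d .
  note cf = nonsplit_conjugate[OF d fp] and cg = nonsplit_conjugate[OF h]
  have a1: "f x \<in> B" if "x \<in> A" "g (f x) \<noteq> x" for x
    using c that unfolding closed_pair_def by blast
  have a2: "g x \<in> A" if "x \<in> B" "f (g x) \<noteq> x" for x
    using c that unfolding closed_pair_def by blast
  have d1: "w \<in> A" if "x \<in> A" "f x \<in> B" "f (g (f x)) \<noteq> f x \<or> g (f x) = x" "f w \<noteq> f x \<or> w = x" for x w
    using c that cf unfolding closed_pair_def by metis
  have d2: "w \<in> B" if "x \<in> B" "g x \<in> A" "g (f (g x)) \<noteq> g x \<or> f (g x) = x" "g w \<noteq> g x \<or> w = x" for x w
    using c that cg unfolding closed_pair_def by metis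
  have im: "f x = f p \<or> f x = f q" for x using U[of x] fp by auto
  have a: "f p \<in> B" using a1[OF \<open>p \<in> A\<close>] good by metis
  have q: "q \<in> A" "q' \<in> A" using d1[OF \<open>p \<in> A\<close> a] good fp by metis+
  have b: "f q \<in> B" using a1[OF q(1)] a1[OF q(2)] fp d by (metis distinct_length_2_or_more)
  have fga: "f (g (f p)) = f q" using im good by metis
  hence "g (f p) = q \<or> g (f p) = q'" using U[of "g (f p)"] fp by auto
  hence ga: "g (f p) \<in> A" using q by auto
  have "B = UNIV \<and> p' \<in> A"
  proof (cases "g (f q) = g (f p)")
    case True
    have "w \<in> B" for w
      using d2[OF b, of w] ga True fga a g fp unfolding two_to_one_def by metis
    moreover have "p' \<in> A" using d1[OF ga, of p'] fga b True fp by metis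
    ultimately show ?thesis by blast
  next
    case False
    have wB: "w \<in> B" if "g w \<noteq> g (f p)" for w using d2[OF a ga] False fga that by metis
    have "g (f q) \<in> A"
    proof (cases "g (f q) = p'")
      case True thus ?thesis using a2[OF b] fp by metis
    next
      case False thus ?thesis using U[of "g (f q)"] \<open>p \<in> A\<close> q by auto
    qed
    hence "w \<in> B" if "g w \<noteq> g (f q)" for w
      using d2[OF b] that False im by metis
    hence "B = UNIV" using wB False by (metis UNIV_eq_I)
    moreover have "p' \<in> A"
    proof (cases "g (f q) = q'")
      case True
      thus ?thesis using d1[OF q(2), of p'] b fp by auto
    next
      case False
      hence "f (g (f q)) \<noteq> f q \<or> g (f q) = q" using U[of "g (f q)"] fp by auto
      thus ?thesis using d1[OF q(1) b, of p'] fp by auto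
    qed
    ultimately show ?thesis by blast
  qed
  moreover have "x \<in> A" if "p' \<in> A" for x using U[of x] \<open>p \<in> A\<close> q that by auto
  ultimately show "A = UNIV \<and> B = UNIV" by blast
qed

text \<open>The points p', y, z, z' are those that \<open>G_exceptional_nonsplit\<close> provides;
  closure adds q, p, q' and y' in this order.\<close>

lemma generation_exceptional_nonsplit:
  assumes d: "distinct [p, p', q, q']" and fp: "f p = y" "f p' = y" "f q = z" "f q' = z"
    and h: "distinct [y, y', z, z']" and gy: "g y = p" "g y' = p" "g z = q" "g z' = q"
  shows "exceptional_nonsplit f g p p' q q' y y' z z'"
  unfolding exceptional_nonsplit_def
proof (intro conjI allI impI d fp h gy)
  fix A B assume c: "closed_pair f g A B" and m: "p' \<in> A" "y \<in> B" "z \<in> B" "z' \<in> B"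
  have U: "x = p \<or> x = p' \<or> x = q \<or> x = q'" "x = y \<or> x = y' \<or> x = z \<or> x = z'" for x
    using pt_exhaust4 d h by blast+
  have cf: "conjugate f x w \<longleftrightarrow> f w = f x \<and> w \<noteq> x" for x w
    using nonsplit_conjugate[of p p' q q' f] d h fp by auto
  have cg: "conjugate g x w \<longleftrightarrow> g w = g x \<and> w \<noteq> x" for x w
    using nonsplit_conjugate[of y y' z z' g] d h gy by auto
  have a2: "g x \<in> A" if "x \<in> B" "f (g x) \<noteq> x" for x
    using c that unfolding closed_pair_def by blast
  have d1: "w \<in> A" if "x \<in> A" "f x \<in> B" "g (f x) = x" "f w \<noteq> f x \<or> w = x" for x w
    using c that cf unfolding closed_pair_def by metis
  have d2: "w \<in> B" if "x \<in> B" "g x \<in> A" "f (g x) = x" "g w \<noteq> g x \<or> w = x" for x w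
    using c that cg unfolding closed_pair_def by metis
  have q: "q \<in> A" using a2[OF m(4)] gy fp h by auto
  have p: "p \<in> A" using d1[OF q, of p] m fp gy h by auto
  have "q' \<in> A" using d1[OF p, of q'] m fp gy h by auto
  moreover have "y' \<in> B" using d2[OF m(3), of y'] q gy fp d by auto
  ultimately have "x \<in> A" "w \<in> B" for x w using U(1)[of x] U(2)[of w] p q m by auto
  thus "A = UNIV" "B = UNIV" by blast+
qed

text \<open>If one map has fibre type (2,1,1), one of its two ramification points is not fixed by
  the composite and \<open>generation_split\<close> applies. If both maps have type (2,2), only the
  case in which f after g fixes both values of f is exceptional.\<close>

lemma generation:
  assumes f: "two_to_one f" and g: "two_to_one g"
    and eckf: "unique_eckardt f g"
    and eckg: "unique_eckardt g f"
  shows "(\<exists>p. generates f g p) \<or> (\<exists>y. generates g f y) \<or>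
     (\<exists>p0 p1 p2 p3 y0 y1 y2 y3. exceptional_split f g p0 p1 p2 p3 y0 y1 y2 y3) \<or>
     (\<exists>p0 p1 p2 p3 y0 y1 y2 y3. exceptional_split g f p0 p1 p2 p3 y0 y1 y2 y3) \<or>
     (\<exists>p p' q q' y y' z z'. exceptional_nonsplit f g p p' q q' y y' z z')"
proof -
  have split_case: "(\<exists>p. generates f g p) \<or> (\<exists>y. generates g f y) \<or>
     (\<exists>p0 p1 p2 p3 y0 y1 y2 y3. exceptional_split f g p0 p1 p2 p3 y0 y1 y2 y3)"
    if "distinct [p, q, r, s]" "f r = f s" "distinct [f p, f q, f r]"
      and fg: "two_to_one f" "two_to_one g"
      and eckf: "unique_eckardt f g"
      and eckg: "unique_eckardt g f"
    for f g p q r s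
  proof -
    have U: "x = p \<or> x = q \<or> x = r \<or> x = s" for x using pt_exhaust4 that(1) .
    have "ramified f p" "ramified f q" using split_ramified[OF that(1-3)] by simp_all
    hence "g (f p) \<noteq> p \<or> g (f q) \<noteq> q" using eckf that(1) unfolding unique_eckardt_def by auto
    thus ?thesis
      using generation_split[OF fg eckf eckg, of p q r s] generation_split[OF fg eckf eckg, of q p r s] that
      by auto
  qed
  from f show ?thesis
  proof (cases rule: two_to_one_shape)
    case (split p q r s)
    thus ?thesis using split_case[OF split f g eckf eckg] by blast
  next
    case (nonsplit p p' q q')
    note fn = nonsplit
    from g show ?thesis
    proof (cases rule: two_to_one_shape)
      case (split p q r s)
      thus ?thesis using split_case[OF split g f eckg eckf] by blast
    next
      case (nonsplit y y' z z')
      consider "f (g (f p)) \<noteq> f p" | "f (g (f q)) \<noteq> f q"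
        | "f (g (f p)) = f p" "f (g (f q)) = f q" by blast
      thus ?thesis
      proof cases
        case 1
        from generation_nonsplit[OF fn nonsplit g 1] show ?thesis by (rule disjI1[OF exI])
      next
        case 2
        have "distinct [q, q', p, p']" "f q \<noteq> f p" using fn by auto
        from generation_nonsplit[OF this(1) fn(3,2) this(2) nonsplit g 2]
        show ?thesis by (rule disjI1[OF exI])
      next
        case 3
        obtain P' where P': "f P' = f (g (f p))" "P' \<noteq> g (f p)"
          using nonsplit_conjugate(2)[OF fn] by blast
        obtain Q' where Q': "f Q' = f (g (f q))" "Q' \<noteq> g (f q)"
          using nonsplit_conjugate(2)[OF fn] by blast
        obtain Y' where Y': "g Y' = g (f p)" "Y' \<noteq> f p"
          using nonsplit_conjugate(2)[OF nonsplit] by blast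
        obtain Z' where Z': "g Z' = g (f q)" "Z' \<noteq> f q"
          using nonsplit_conjugate(2)[OF nonsplit] by blast
        have ne: "g (f p) \<noteq> g (f q)" using 3 fn by metis
        have "distinct [g (f p), P', g (f q), Q']" "distinct [f p, Y', f q, Z']"
          using P' Q' Y' Z' 3 ne fn(4) by auto
        hence "exceptional_nonsplit f g (g (f p)) P' (g (f q)) Q' (f p) Y' (f q) Z'"
          using generation_exceptional_nonsplit P' Q' Y' Z' 3 by metis
        thus ?thesis by (intro disjI2 exI)
      qed
    qed
  qed
qed

subsection \<open>From points of the two lines to the whole surface\<close>

fun rep :: "pt \<Rightarrow> v2" where
  "rep P0 = (1, 0)" | "rep P1 = (0, 1)" | "rep P2 = (1, 1)" | "rep P3 = (1, -1)"

definition dir :: "v2 \<Rightarrow> pt \<Rightarrow> bool" where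
  "dir x p \<longleftrightarrow> x = rep p \<or> x = - rep p"

lemma dir_rep [simp]: "dir (rep p) p" "dir (- rep p) p"
  by (simp_all add: dir_def)

lemma rep_nonzero [simp]: "rep p \<noteq> 0"
  by (cases p) (simp_all add: zero_prod_def)

lemma dir_exists:
  assumes "x \<noteq> 0"
  obtains p where "dir x p"
proof -
  obtain a b where x: "x = (a, b)" by (cases x)
  have "dir x P0 \<or> dir x P1 \<or> dir x P2 \<or> dir x P3"
    using assms f3_cases[of a] f3_cases[of b] unfolding x dir_def
    by (elim disjE) (simp_all add: zero_prod_def)
  thus ?thesis using that by blast
qed

lemma det2_rep: "det2 (rep p) (rep q) = 0 \<longleftrightarrow> p = q"
  by (cases p; cases q) (simp_all add: det2_def)

lemma dir_eq: "dir x p \<Longrightarrow> dir y q \<Longrightarrow> det2 x y = 0 \<longleftrightarrow> p = q"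
  using det2_rep[of p q] by (auto simp: dir_def det2_def)

text \<open>Replacing y by -y exchanges the directions of the sum and the difference, so any
  prescribed order of the last two directions can be met.\<close>

lemma dir_complement:
  assumes "distinct [p, q, r, s]"
  obtains y where "dir y q" "dir (rep p + y) r" "dir (rep p - y) s"
proof -
  have "\<exists>y. dir y q \<and> dir (rep p + y) r \<and> dir (rep p - y) s"
  proof (cases "dir (rep p + rep q) r")
    case True
    hence "dir (rep p - rep q) s" using assms
      by (cases p; cases q; cases r; cases s) (simp_all add: dir_def)
    thus ?thesis using True dir_rep by metis
  next
    case False
    hence "dir (rep p + - rep q) r \<and> dir (rep p - - rep q) s" using assms
      by (cases p; cases q; cases r; cases s) (simp_all add: dir_def)
    thus ?thesis using dir_rep by metis
  qed
  thus ?thesis using that by blast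
qed

section \<open>The maps of degree two given by the bihomogeneous parts\<close>

lemma linear_root:
  assumes "\<And>v w. L (v + w) = L v + (L w :: f3)" and "L v \<noteq> 0"
  shows "\<exists>!q. L (rep q) = 0"
proof -
  have L0: "L 0 = 0" using assms(1)[of 0 0] by simp
  have Lm: "L (- w) = - L w" for w using assms(1)[of w "- w"] L0 by (simp add: add_eq_0_iff)
  define a b where "a = L (rep P0)" and "b = L (rep P1)"
  have c: "L (rep P2) = a + b" "L (rep P3) = a - b"
    using assms(1)[of "rep P0" "rep P1"] assms(1)[of "rep P0" "- rep P1"] Lm[of "rep P1"]
    by (simp_all add: a_def b_def)
  have "a \<noteq> 0 \<or> b \<noteq> 0"
  proof (rule ccontr)
    assume "\<not> (a \<noteq> 0 \<or> b \<noteq> 0)"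
    hence "L (rep q) = 0" for q using c by (cases q) (simp_all add: a_def b_def)
    moreover obtain q where "dir v q" using assms(2) L0 dir_exists[of v] by metis
    ultimately show False using assms(2) Lm[of "rep q"] unfolding dir_def by auto
  qed
  hence "a = 0 \<or> b = 0 \<or> a + b = 0 \<or> a - b = 0"
    using f3_cases[of a] f3_cases[of b] by (elim disjE) simp_all
  hence "\<exists>q. L (rep q) = 0" using c unfolding a_def b_def by metis
  moreover have "q = r" if "L (rep q) = 0" "L (rep r) = 0" for q r
  proof (rule ccontr)
    assume "q \<noteq> r"
    have Ld: "L (x - y) = L x - L y" for x y using assms(1)[of x "- y"] Lm[of y] by simp
    from \<open>q \<noteq> r\<close> v2_span[of "rep q" "rep r" v] have "L v = 0"
      by (simp add: det2_rep, elim disjE) (simp_all add: assms(1) Ld Lm that L0)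
    thus False using assms(2) by simp
  qed
  ultimately show ?thesis by blast
qed

text \<open>For \<open>al\<close> this is the map f, and for \<open>be\<close> with its arguments
  exchanged the map g. The description is unique when \<open>h (rep p)\<close> is a nonzero linear
  form, by \<open>linear_root\<close>.\<close>

definition dirmap :: "(v2 \<Rightarrow> v2 \<Rightarrow> f3) \<Rightarrow> pt \<Rightarrow> pt" where
  "dirmap h p = (THE q. h (rep p) (rep q) = 0)"

text \<open>The consequences of smoothness that suffice from here on: the last assumption is a
  nonzero derivative, as in \<open>F_polar_add\<close>, at every rational point, while the first two
  exclude singular points on the lines that may be defined only over the closure.\<close>

locale smooth_skew_cubic = skew_cubic +
  assumes al_nonzero: "y \<noteq> 0 \<Longrightarrow> \<exists>x. al x y \<noteq> 0"
    and be_nonzero: "x \<noteq> 0 \<Longrightarrow> \<exists>y. be x y \<noteq> 0"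
    and nonsingular: "x \<noteq> 0 \<or> y \<noteq> 0 \<Longrightarrow> F x y = 0 \<Longrightarrow>
          \<exists>v w. F (x - v) (y - w) - F (x + v) (y + w) \<noteq> F v w"

lemma skew_cubic_dual: "skew_cubic al be \<Longrightarrow> skew_cubic (\<lambda>y x. be x y) (\<lambda>y x. al x y)"
  by (simp add: skew_cubic_def)

lemma F_dual: "skew_cubic al be \<Longrightarrow> skew_cubic.F (\<lambda>y x. be x y) (\<lambda>y x. al x y) y x = skew_cubic.F al be x y"
  by (simp add: skew_cubic.F_def skew_cubic_dual add.commute)

lemma closed_set_dual: "closed_set al be G \<Longrightarrow> closed_set (\<lambda>y x. be x y) (\<lambda>y x. al x y) (\<lambda>y x. G x y)"
  unfolding closed_set_def closed_set_axioms_def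
  by (intro conjI) (simp add: skew_cubic_dual, simp_all add: F_dual)

lemma smooth_skew_cubic_dual:
  "smooth_skew_cubic al be \<Longrightarrow> smooth_skew_cubic (\<lambda>y x. be x y) (\<lambda>y x. al x y)"
proof -
  assume a: "smooth_skew_cubic al be"
  then interpret smooth_skew_cubic al be .
  show ?thesis
  proof (intro smooth_skew_cubic.intro smooth_skew_cubic_axioms.intro)
    show "skew_cubic (\<lambda>y x. be x y) (\<lambda>y x. al x y)"
      by (rule skew_cubic_dual) unfold_locales
    fix y x :: v2
    assume "y \<noteq> 0 \<or> x \<noteq> 0" "skew_cubic.F (\<lambda>y x. be x y) (\<lambda>y x. al x y) y x = 0"
    hence "\<exists>v w. F (x - v) (y - w) - F (x + v) (y + w) \<noteq> F v w"
      using nonsingular[of x y] by (auto simp: F_dual[OF skew_cubic_axioms])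
    thus "\<exists>w v. skew_cubic.F (\<lambda>y x. be x y) (\<lambda>y x. al x y) (y - w) (x - v)
        - skew_cubic.F (\<lambda>y x. be x y) (\<lambda>y x. al x y) (y + w) (x + v)
        \<noteq> skew_cubic.F (\<lambda>y x. be x y) (\<lambda>y x. al x y) w v"
      unfolding F_dual[OF skew_cubic_axioms] by blast
  qed (use al_nonzero be_nonzero in auto)
qed

context smooth_skew_cubic
begin

text \<open>At the point (x, 0) the derivative in the direction (v, w) is just
  \<open>al x w\<close>.\<close>

lemma al_nonzero':
  assumes "x \<noteq> 0" shows "\<exists>y. al x y \<noteq> 0"
proof -
  obtain v w where "F (x - v) (0 - w) - F (x + v) (0 + w) \<noteq> F v w"
    using nonsingular[of x 0] assms by auto
  hence "F x (- w) \<noteq> F x w" using F_polar_add[of x v 0 w] by auto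
  hence "al x w \<noteq> 0" by (auto simp: F_def)
  thus ?thesis by blast
qed

lemma al_dir:
  assumes "dir x p" "dir y q"
  shows "al x y = 0 \<longleftrightarrow> q = dirmap al p"
proof -
  obtain v where "al (rep p) v \<noteq> 0" using al_nonzero'[of "rep p"] by auto
  hence ex1: "\<exists>!q. al (rep p) (rep q) = 0" using linear_root[of "al (rep p)", OF al_add] by blast
  have "al (rep p) (rep q) = 0 \<longleftrightarrow> q = dirmap al p"
    using theI'[OF ex1] ex1 unfolding dirmap_def by metis
  thus ?thesis using assms by (auto simp: dir_def)
qed

lemma al_rep: "al (rep p) (rep q) = 0 \<longleftrightarrow> q = dirmap al p"
  by (rule al_dir) simp_all

lemma al_column_sum: "(\<Sum>p\<in>{P0, P1, P2, P3}. al (rep p) y) = 0"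
  using al_quad[of "rep P0" "rep P1" y] by (simp add: add_eq_0_iff algebra_simps)

text \<open>By \<open>al_column_sum\<close>, three zeros in a column force a fourth, against
  \<open>al_nonzero\<close>. If the map were injective, each column would have one zero and three
  equal nonzero entries; the rows through the zeros of columns P2 and P3 would then give a + b = 0
  and a - b = 0 with a nonzero.\<close>

lemma two_to_one_al: "two_to_one (dirmap al)"
  unfolding two_to_one_def
proof (intro conjI allI impI notI)
  fix p q r
  assume eq: "dirmap al p = dirmap al q" "dirmap al q = dirmap al r"
  show "p = q \<or> q = r \<or> p = r"
  proof (rule ccontr)
    assume "\<not> ?thesis"
    hence "distinct [p, q, r]" by auto
    then obtain s where d: "distinct [p, q, r, s]" by (rule pt_extend1)
    define y where "y = rep (dirmap al p)"
    have z: "al (rep p) y = 0" "al (rep q) y = 0" "al (rep r) y = 0"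
      using eq by (simp_all add: y_def al_rep)
    have "{P0, P1, P2, P3} = {p, q, r, s}" using pt_exhaust4[OF d] UNIV_pt by blast
    hence "(\<Sum>p\<in>{p, q, r, s}. al (rep p) y) = 0" using al_column_sum[of y] by simp
    hence "al (rep s) y = 0" using d z by simp
    hence "al (rep t) y = 0" for t using pt_exhaust4[OF d, of t] z by auto
    hence "al x y = 0" for x by (metis al_0(2) al_minus(2) dir_def dir_exists)
    thus False using al_nonzero[of y] by (simp add: y_def)
  qed
next
  assume inj: "inj (dirmap al)"
  moreover have "finite (UNIV :: pt set)" by (simp add: UNIV_pt)
  ultimately have "bij (dirmap al)" by (metis finite_UNIV_inj_surj bij_def)
  then obtain h where h: "\<And>q. dirmap al (h q) = q" by (metis bij_pointE)
  have zero: "al (rep p) (rep q) = 0 \<longleftrightarrow> p = h q" for p q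
    using h inj unfolding al_rep by (metis injD)
  have const: "al (rep p) (rep q) = al (rep r) (rep q)" if "p \<noteq> h q" "r \<noteq> h q" for p q r
  proof (cases "p = r")
    case False
    hence "distinct [h q, p, r]" using that by auto
    then obtain s where d: "distinct [h q, p, r, s]" by (rule pt_extend1)
    define a b c where "a = al (rep p) (rep q)" and "b = al (rep r) (rep q)" and "c = al (rep s) (rep q)"
    have "{P0, P1, P2, P3} = {h q, p, r, s}" using pt_exhaust4[OF d] UNIV_pt by blast
    hence "(\<Sum>p\<in>{h q, p, r, s}. al (rep p) (rep q)) = 0" using al_column_sum[of "rep q"] by simp
    hence "a + (b + c) = 0" using d zero[of "h q" q] by (simp add: a_def b_def c_def)
    moreover have "a \<noteq> 0" "b \<noteq> 0" "c \<noteq> 0" using zero d by (auto simp: a_def b_def c_def)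
    ultimately show ?thesis unfolding a_def[symmetric] b_def[symmetric]
      using f3_cases[of a] f3_cases[of b] f3_cases[of c] by (elim disjE) simp_all
  qed simp
  have hd: "h q \<noteq> h r" if "q \<noteq> r" for q r using h that by metis
  define a b where "a = al (rep (h P2)) (rep P0)" and "b = al (rep (h P2)) (rep P1)"
  have "a = al (rep (h P3)) (rep P0)" "b = al (rep (h P3)) (rep P1)"
    unfolding a_def b_def by (intro const; simp add: hd)+
  moreover have "rep P2 = rep P0 + rep P1" "rep P3 = rep P0 - rep P1" by simp_all
  moreover have "al (rep (h P2)) (rep P2) = 0" "al (rep (h P3)) (rep P3) = 0" by (simp_all only: zero)
  ultimately have "a + b = 0" "a - b = 0"
    unfolding a_def b_def by (metis al_add, metis al_diff)
  hence "a = 0" using f3_cases[of a] by auto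
  thus False unfolding a_def zero using hd[of P2 P0] by simp
qed

end

section \<open>From closed sets on the surface to closed pairs of points on the lines\<close>

locale smooth_closed_set = smooth_skew_cubic + closed_set
begin

lemma dual: "smooth_closed_set (\<lambda>y x. be x y) (\<lambda>y x. al x y) (\<lambda>y x. G x y)"
  unfolding smooth_closed_set_def
  by (simp add: smooth_skew_cubic_dual closed_set_dual smooth_skew_cubic_axioms closed_set_axioms)

lemma be_dir: "dir x p \<Longrightarrow> dir y q \<Longrightarrow> be x y = 0 \<longleftrightarrow> p = dirmap (\<lambda>y x. be x y) q"
  using smooth_skew_cubic.al_dir[OF smooth_skew_cubic_dual[OF smooth_skew_cubic_axioms], of y q x p] by blast

abbreviation (input) "f \<equiv> dirmap al"
abbreviation (input) "g \<equiv> dirmap (\<lambda>y x. be x y)"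

lemma G_dir_x: "dir x p \<Longrightarrow> G x 0 \<longleftrightarrow> G (rep p) 0"
  using G_minus[of "rep p" 0] G_minus[of "- rep p" 0] by (auto simp: dir_def)

lemma G_dir_y: "dir y q \<Longrightarrow> G 0 y \<longleftrightarrow> G 0 (rep q)"
  using G_minus[of 0 "rep q"] G_minus[of 0 "- rep q"] by (auto simp: dir_def)

lemma G_step_tangent:
  assumes "G (rep p) 0" "g (f p) \<noteq> p"
  shows "G 0 (rep (f p))"
proof (rule G_transversal_tangent[OF assms(1)])
  show "al (rep p) (rep (f p)) = 0" by (simp only: al_rep)
  show "be (rep p) (rep (f p)) \<noteq> 0" using be_dir[of "rep p" p "rep (f p)" "f p"] assms(2) by auto
qed

text \<open>An application of \<open>G_plane_conic\<close> at x = \<open>g q\<close>: a zero of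
  \<open>be x\<close> in a direction other than q is the conjugate of q, and by assumption it is not
  the zero of \<open>al x\<close>.\<close>

lemma G_step_plane:
  assumes y: "G 0 (rep q)" and x: "G (rep (g q)) 0"
    and c: "\<not> conjugate g q (f (g q))" "\<not> conjugate g q r"
  shows "G 0 (rep r)"
proof (cases "r = q")
  case False
  define x y z where "x = rep (g q)" and "y = rep q" and "z = rep r"
  have dx: "dir x (g q)" and dy: "dir y q" and dz: "dir z r" by (simp_all add: x_def y_def z_def)
  have det: "det2 z y \<noteq> 0" using dir_eq[OF dz dy] False by simp
  have conj: "al x v \<noteq> 0 \<and> conjugate g q t" if "be x v = 0" "dir v t" "t \<noteq> q" for v t
  proof -
    have "g t = g q" using be_dir[OF dx that(2)] that(1) by simp
    hence "conjugate g q t" using that(3) by (simp add: conjugate_def)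
    thus ?thesis using c(1) al_dir[OF dx that(2)] by auto
  qed
  have ne: "v \<noteq> 0 \<and> (\<forall>t. dir v t \<longrightarrow> t \<noteq> q)" if "det2 v y \<noteq> 0" for v
    using that dir_eq[OF _ dy, of v] by (auto simp: det2_def)
  have dets: "det2 (z + y) y \<noteq> 0" "det2 (z - y) y \<noteq> 0" using det by (auto simp: det2_def algebra_simps)
  have main: "al x v \<noteq> 0" if "be x v = 0" "det2 v y \<noteq> 0" for v
    using conj[OF that(1)] ne[OF that(2)] dir_exists[of v] by metis
  have "G 0 z"
  proof (rule G_plane_conic)
    show "G x 0" "G 0 y" using x y by (simp_all add: x_def y_def)
    show "be x y = 0" using be_dir[OF dx dy] by simp
    show "be x z \<noteq> 0" using conj[of z r] dz c(2) False by blast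
    show "al x (z + y) \<noteq> 0" if "be x (z + y) = 0" using main that dets by blast
    show "al x (z - y) \<noteq> 0" if "be x (z - y) = 0" using main that dets by blast
    show "al x y \<noteq> 0" if h: "be x (z + y) \<noteq> 0" "be x (z - y) \<noteq> 0"
    proof -
      \<comment> \<open>If \<open>be x\<close> vanishes at neither sum nor difference, its only zero
        is the double one at q; q is then its own conjugate, and the assumption becomes
        \<open>f (g q)\<close> different from q.\<close>
      have "ramified g q"
        unfolding ramified_def
      proof (intro allI impI)
        fix t assume t: "g t = g q"
        have b0: "be x (rep t) = 0" using be_dir[OF dx, of "rep t" t] t by simp
        have "be x z \<noteq> 0" using conj[of z r] dz c(2) False by blast
        moreover have "- z + y = - (z - y)" "- z - y = - (z + y)" by simp_all
        hence "be x (- z + y) = be x (z - y)" "be x (- z - y) = be x (z + y)"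
          by (simp_all only: be_minus)
        ultimately have "be x w \<noteq> 0" if "w \<in> {z, - z, z + y, z - y, - z + y, - z - y}" for w
          using that h by (elim insertE emptyE) simp_all
        hence "rep t \<in> {0, y, - y}" using v2_span[OF det, of "rep t"] b0 by blast
        hence "dir y t" by (auto simp: dir_def)
        thus "t = q" using dir_eq[OF _ dy, of y t] by (simp add: det2_def)
      qed
      hence "f (g q) \<noteq> q" using c(1) by (auto simp: conjugate_def)
      thus ?thesis using al_dir[OF dx dy] by simp
    qed
  qed
  thus ?thesis by (simp add: z_def)
qed (use y in simp)

lemma closed_pair_G: "closed_pair f g {p. G (rep p) 0} {q. G 0 (rep q)}"
  using G_step_tangent smooth_closed_set.G_step_tangent[OF dual]
    G_step_plane smooth_closed_set.G_step_plane[OF dual]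
  unfolding closed_pair_def by blast

lemma G_all:
  assumes x: "\<And>p. G (rep p) 0" and y: "\<And>q. G 0 (rep q)"
    and "v \<noteq> 0 \<or> w \<noteq> 0" "F v w = 0"
  shows "G v w"
proof -
  have Gx: "G v 0" if "v \<noteq> 0" for v using x G_dir_x dir_exists[OF that] by metis
  have Gy: "G 0 w" if "w \<noteq> 0" for w using y G_dir_y dir_exists[OF that] by metis
  consider "v = 0" | "w = 0" | "v \<noteq> 0" "w \<noteq> 0" "al v w \<noteq> 0" | "v \<noteq> 0" "w \<noteq> 0" "al v w = 0" by blast
  thus ?thesis
  proof cases
    case 1 thus ?thesis using Gy assms(3) by simp
  next
    case 2 thus ?thesis using Gx assms(3) by simp
  next
    case 3 thus ?thesis using G_transversal_chord Gx Gy assms(4) by simp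
  next
    case 4
    hence be0: "be v w = 0" using assms(4) by (simp add: F_def)
    obtain t s where ne: "al t w \<noteq> 0" "be v s \<noteq> 0" using al_nonzero be_nonzero 4 by metis
    obtain t' where ne2: "be t' w \<noteq> 0"
      using smooth_skew_cubic.al_nonzero'[OF smooth_skew_cubic_dual[OF smooth_skew_cubic_axioms]] 4 by metis
    obtain s' where ne3: "al v s' \<noteq> 0" using al_nonzero' 4 by metis
    obtain d e where "F (v - d) (w - e) - F (v + d) (w + e) \<noteq> F d e"
      using nonsingular assms by metis
    \<comment> \<open>The derivative is the sum of its parts along the two lines, so one part is
      nonzero and selects \<open>G_on_transversal\<close> or its dual.\<close>
    hence "F (v - d) w \<noteq> F (v + d) w \<or> F v (w - e) \<noteq> F v (w + e)"
      using F_polar_add[of v d w e] by auto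
    thus ?thesis
    proof
      assume "F (v - d) w \<noteq> F (v + d) w"
      thus ?thesis using G_on_transversal[OF Gx Gy 4(1,2,3) be0 ne(1) ne2] by blast
    next
      assume "F v (w - e) \<noteq> F v (w + e)"
      thus ?thesis
        using closed_set.G_on_transversal[OF closed_set_dual[OF closed_set_axioms] Gy Gx 4(2,1) be0 4(3) ne(2) ne3]
        by (simp add: F_dual[OF skew_cubic_axioms])
    qed
  qed
qed

lemma G_generates:
  assumes "generates f g p" "G (rep p) 0" "v \<noteq> 0 \<or> w \<noteq> 0" "F v w = 0"
  shows "G v w"
proof -
  have "{p. G (rep p) 0} = UNIV \<and> {q. G 0 (rep q)} = UNIV"
    using assms(1,2) closed_pair_G unfolding generates_def by blast
  thus ?thesis using G_all assms(3,4) by blast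
qed

lemma G_exceptional_split_all:
  assumes e: "exceptional_split f g p0 p1 p2 p3 y0 y1 y2 y3"
    and G: "G (rep p1) 0" and "v \<noteq> 0 \<or> w \<noteq> 0" "F v w = 0"
  shows "G v w"
proof -
  note es = e[unfolded exceptional_split_def]
  have d: "distinct [p0, p1, p2, p3]" "distinct [y0, y1, y2, y3]" using es by blast+
  have fs: "f p0 = y0" "f p1 = y1" "f p2 = y2" "f p3 = y2" and gs: "g y0 = p0" "g y1 = p0" "g y2 = p2" "g y3 = p3"
    using es by blast+
  have full: "A = UNIV \<and> (y0 \<in> B \<longrightarrow> B = UNIV)" if "closed_pair f g A B" "p1 \<in> A" for A B
    using es that by blast
  have X: "{p. G (rep p) 0} = UNIV" using full[OF closed_pair_G] G by simp
  obtain x1 where x: "dir x1 p1" "dir (rep p0 + x1) p2" "dir (rep p0 - x1) p3" using dir_complement[OF d(1)] .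
  obtain z1 where y: "dir z1 y1" "dir (rep y0 + z1) y2" "dir (rep y0 - z1) y3" using dir_complement[OF d(2)] .
  have r: "dir (rep p0) p0" "dir (rep y0) y0" by simp_all
  note a = al_dir and b = be_dir
  have "G 0 (rep y0)"
  proof (rule G_exceptional_split[of "rep p0" "rep y0" x1 z1])
    show "G (rep p0 + x1) 0" using X G_dir_x[OF x(2)] by blast
    show "al (rep p0) (rep y0) = 0" "al x1 z1 = 0" "al (rep p0 + x1) (rep y0 + z1) = 0" "al (rep p0 - x1) (rep y0 + z1) = 0"
      using a[OF r] a[OF x(1) y(1)] a[OF x(2) y(2)] a[OF x(3) y(2)] fs by simp_all
    show "al x1 (rep y0) \<noteq> 0" "al (rep p0 + x1) (rep y0) \<noteq> 0" "al (rep p0 - x1) (rep y0) \<noteq> 0" "al (rep p0) z1 \<noteq> 0"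
      using a[OF x(1) r(2)] a[OF x(2) r(2)] a[OF x(3) r(2)] a[OF r(1) y(1)] fs d(2) by auto
    show "be (rep p0) (rep y0) = 0" "be (rep p0) z1 = 0" "be (rep p0 + x1) (rep y0 + z1) = 0" "be (rep p0 - x1) (rep y0 - z1) = 0"
      using b[OF r] b[OF r(1) y(1)] b[OF x(2) y(2)] b[OF x(3) y(3)] gs by simp_all
    show "be x1 (rep y0) \<noteq> 0" "be x1 z1 \<noteq> 0" "be (rep p0) (rep y0 + z1) \<noteq> 0"
      using b[OF x(1) r(2)] b[OF x(1) y(1)] b[OF r(1) y(2)] gs d(1) by auto
  qed
  hence "{q. G 0 (rep q)} = UNIV" using full[OF closed_pair_G] G by simp
  thus ?thesis using G_all X assms(3,4) by blast
qed

lemma G_exceptional_nonsplit_all: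
  assumes e: "exceptional_nonsplit f g p p' q q' y y' z z'"
    and G: "G (rep p') 0" and "v \<noteq> 0 \<or> w \<noteq> 0" "F v w = 0"
  shows "G v w"
proof -
  note es = e[unfolded exceptional_nonsplit_def]
  have d: "distinct [p, q, p', q']" "distinct [y, z, y', z']" using es by auto
  have fs: "f p = y" "f p' = y" "f q = z" "f q' = z" and gs: "g y = p" "g y' = p" "g z = q" "g z' = q"
    using es by blast+
  have full: "A = UNIV \<and> B = UNIV" if "closed_pair f g A B" "p' \<in> A" "y \<in> B" "z \<in> B" "z' \<in> B" for A B
    using es that by blast
  obtain x1 where x: "dir x1 q" "dir (rep p + x1) p'" "dir (rep p - x1) q'" using dir_complement[OF d(1)] .
  obtain z1 where y: "dir z1 z" "dir (rep y + z1) y'" "dir (rep y - z1) z'" using dir_complement[OF d(2)] .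
  have r: "dir (rep p) p" "dir (rep y) y" by simp_all
  note a = al_dir and b = be_dir
  have "G 0 (rep y) \<and> G 0 z1 \<and> G 0 (rep y - z1)"
  proof (rule G_exceptional_nonsplit[of "rep p" "rep y" x1 z1])
    show "G (rep p + x1) 0" using G G_dir_x[OF x(2)] by blast
    show "al (rep p) (rep y) = 0" "al (rep p + x1) (rep y) = 0" "al x1 z1 = 0" "al (rep p - x1) z1 = 0"
      using a[OF r] a[OF x(2) r(2)] a[OF x(1) y(1)] a[OF x(3) y(1)] fs by simp_all
    show "al x1 (rep y) \<noteq> 0" "al (rep p) z1 \<noteq> 0"
      using a[OF x(1) r(2)] a[OF r(1) y(1)] fs d(2) by auto
    show "be (rep p) (rep y) = 0" "be (rep p) (rep y + z1) = 0" "be x1 z1 = 0" "be x1 (rep y - z1) = 0"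
      using b[OF r] b[OF r(1) y(2)] b[OF x(1) y(1)] b[OF x(1) y(3)] gs by simp_all
    show "be (rep p) z1 \<noteq> 0" "be x1 (rep y) \<noteq> 0"
      using b[OF r(1) y(1)] b[OF x(1) r(2)] gs d(1) by auto
    show "det2 (rep p) x1 \<noteq> 0" "det2 (rep y) z1 \<noteq> 0"
      using dir_eq[OF r(1) x(1)] dir_eq[OF r(2) y(1)] d by auto
    fix c assume c: "c = rep y \<or> c = - rep y"
    have "F (rep p) c = 0" using c a[OF r] b[OF r] fs gs by (auto simp: F_def)
    thus "\<exists>v w. F (rep p - v) (c - w) - F (rep p + v) (c + w) \<noteq> F v w"
      using nonsingular[of "rep p" c] by simp
  qed
  hence "{p. G (rep p) 0} = UNIV \<and> {q. G 0 (rep q)} = UNIV"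
    using full[OF closed_pair_G] G G_dir_y[OF y(1)] G_dir_y[OF y(3)] by simp
  thus ?thesis using G_all assms(3,4) by blast
qed

end

context smooth_skew_cubic
begin

text \<open>The point is chosen before \<open>G\<close>, so that \<open>G\<close> may later be the
  span of that very point. The condition on x and y places it on exactly one of the two
  lines.\<close>

lemma generation_by_one_point:
  assumes "unique_eckardt (dirmap al) (dirmap (\<lambda>y x. be x y))"
    and "unique_eckardt (dirmap (\<lambda>y x. be x y)) (dirmap al)"
  shows "\<exists>x y. (x = 0 \<longleftrightarrow> y \<noteq> 0) \<and> (\<forall>G v w. closed_set al be G \<longrightarrow> G x y \<longrightarrow>
    v \<noteq> 0 \<or> w \<noteq> 0 \<longrightarrow> F v w = 0 \<longrightarrow> G v w)"
proof -
  interpret dual: smooth_skew_cubic "\<lambda>y x. be x y" "\<lambda>y x. al x y"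
    by (rule smooth_skew_cubic_dual) unfold_locales
  have sc: "smooth_closed_set al be G" if "closed_set al be G" for G
    using that smooth_skew_cubic_axioms by (simp add: smooth_closed_set_def)
  have scd: "smooth_closed_set (\<lambda>y x. be x y) (\<lambda>y x. al x y) (\<lambda>y x. G x y)" if "closed_set al be G" for G
    using smooth_closed_set.dual[OF sc[OF that]] .
  have x: ?thesis if "\<And>G v w. closed_set al be G \<Longrightarrow> G (rep p) 0 \<Longrightarrow> v \<noteq> 0 \<or> w \<noteq> 0 \<Longrightarrow> F v w = 0 \<Longrightarrow> G v w" for p
  proof (intro exI conjI allI impI)
    show "rep p = 0 \<longleftrightarrow> (0::v2) \<noteq> 0" by simp
  qed (rule that)
  have y: ?thesis if "\<And>G v w. closed_set al be G \<Longrightarrow> G 0 (rep p) \<Longrightarrow> v \<noteq> 0 \<or> w \<noteq> 0 \<Longrightarrow> F v w = 0 \<Longrightarrow> G v w" for p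
  proof (intro exI conjI allI impI)
    show "(0::v2) = 0 \<longleftrightarrow> rep p \<noteq> 0" by simp
  qed (rule that)
  note Fd = F_dual[OF skew_cubic_axioms]
  from generation[OF two_to_one_al dual.two_to_one_al assms] show ?thesis
  proof (elim disjE exE)
    fix p assume "generates (dirmap al) (dirmap (\<lambda>y x. be x y)) p"
    thus ?thesis using smooth_closed_set.G_generates[OF sc] by (intro x)
  next
    fix q assume "generates (dirmap (\<lambda>y x. be x y)) (dirmap al) q"
    note gen = this
    show ?thesis
    proof (rule y)
      fix G v w
      assume h: "closed_set al be G" "G 0 (rep q)" "v \<noteq> 0 \<or> w \<noteq> 0" "F v w = 0"
      show "G v w"
        using smooth_closed_set.G_generates[OF scd[OF h(1)] gen, of w v] h(2-4) by (simp add: Fd disj_commute)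
    qed
  next
    fix p0 p1 p2 p3 y0 y1 y2 y3
    assume "exceptional_split (dirmap al) (dirmap (\<lambda>y x. be x y)) p0 p1 p2 p3 y0 y1 y2 y3"
    thus ?thesis using smooth_closed_set.G_exceptional_split_all[OF sc] by (intro x)
  next
    fix p0 p1 p2 p3 y0 y1 y2 y3
    assume "exceptional_split (dirmap (\<lambda>y x. be x y)) (dirmap al) p0 p1 p2 p3 y0 y1 y2 y3"
    note gen = this
    show ?thesis
    proof (rule y)
      fix G v w
      assume h: "closed_set al be G" "G 0 (rep p1)" "v \<noteq> 0 \<or> w \<noteq> 0" "F v w = 0"
      show "G v w"
        using smooth_closed_set.G_exceptional_split_all[OF scd[OF h(1)] gen, of w v] h(2-4) by (simp add: Fd disj_commute)
    qed
  next
    fix p p' q q' y y' z z'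
    assume "exceptional_nonsplit (dirmap al) (dirmap (\<lambda>y x. be x y)) p p' q q' y y' z z'"
    thus ?thesis using smooth_closed_set.G_exceptional_nonsplit_all[OF sc] by (intro x)
  qed
qed

end

subsection \<open>Polarization of cubic forms\<close>

text \<open>Writes each cubic monomial as a product of three coordinates, in some order.\<close>

definition tri_index :: "nat^4 \<Rightarrow> 4 \<times> 4 \<times> 4" where
  "tri_index e = (SOME (i, j, k). \<forall>l. e $ l = of_bool (l = i) + of_bool (l = j) + of_bool (l = k))"

lemma sum_Suc_split:
  fixes f :: "'i::finite \<Rightarrow> nat"
  assumes "(\<Sum>l\<in>UNIV. f l) = Suc n"
  shows "\<exists>i f'. (\<forall>l. f l = of_bool (l = i) + f' l) \<and> (\<Sum>l\<in>UNIV. f' l) = n"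
proof -
  obtain i where i: "f i \<noteq> 0" using assms by (metis finite_class.finite_UNIV nat.distinct(1) sum.neutral)
  define f' where "f' l = f l - of_bool (l = i)" for l
  have f: "f l = of_bool (l = i) + f' l" for l using i by (auto simp: f'_def)
  have "(\<Sum>l\<in>UNIV. f l) = 1 + (\<Sum>l\<in>UNIV. f' l)"
    by (simp only: f sum.distrib) (simp add: of_bool_def)
  thus ?thesis using f assms by (intro exI[of _ i] exI[of _ f']) simp
qed

lemma tri_index:
  fixes e :: "nat^4"
  assumes "e \<in> mons3" "tri_index e = (i, j, k)"
  shows "e $ l = of_bool (l = i) + of_bool (l = j) + of_bool (l = k)"
proof -
  have "(\<Sum>l\<in>UNIV. e $ l) = Suc (Suc (Suc 0))" using assms(1) by (simp add: mons3_def)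
  from sum_Suc_split[OF this] obtain i1 f1
    where 1: "\<forall>l. e $ l = of_bool (l = i1) + f1 l" "(\<Sum>l\<in>UNIV. f1 l) = Suc (Suc 0)" by blast
  from sum_Suc_split[OF 1(2)] obtain i2 f2
    where 2: "\<forall>l. f1 l = of_bool (l = i2) + f2 l" "(\<Sum>l\<in>UNIV. f2 l) = Suc 0" by blast
  from sum_Suc_split[OF 2(2)] obtain i3 f3
    where 3: "\<forall>l. f2 l = of_bool (l = i3) + f3 l" "(\<Sum>l\<in>UNIV. f3 l) = 0" by blast
  have "\<exists>t. case t of (i, j, k) \<Rightarrow> \<forall>l. e $ l = of_bool (l = i) + of_bool (l = j) + of_bool (l = k)"
    using 1(1) 2(1) 3 by (intro exI[of _ "(i1, i2, i3)"]) simp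
  from someI_ex[OF this] show ?thesis using assms(2) unfolding tri_index_def by simp
qed

text \<open>A trilinear form whose diagonal is the cubic. It is left unsymmetrized because
  symmetrizing would divide by 6, which is zero here.\<close>

definition tri :: "(nat^4 \<Rightarrow> 'a::comm_ring_1) \<Rightarrow> 'a^4 \<Rightarrow> 'a^4 \<Rightarrow> 'a^4 \<Rightarrow> 'a" where
  "tri c x y z = (\<Sum>e\<in>mons3. c e * (case tri_index e of (i, j, k) \<Rightarrow> x $ i * y $ j * z $ k))"

text \<open>The derivative of the cubic at x in the direction y, quadratic in x and linear in
  y.\<close>

definition pol :: "(nat^4 \<Rightarrow> 'a::comm_ring_1) \<Rightarrow> 'a^4 \<Rightarrow> 'a^4 \<Rightarrow> 'a" where
  "pol c x y = tri c y x x + tri c x y x + tri c x x y"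

definition mix :: "(nat^4 \<Rightarrow> 'a::comm_ring_1) \<Rightarrow> 'a^4 \<Rightarrow> 'a^4 \<Rightarrow> 'a^4 \<Rightarrow> 'a" where
  "mix c x y z = tri c x y z + tri c y x z + tri c x z y + tri c y z x + tri c z x y + tri c z y x"

lemma tri_add:
  "tri c (x + x') y z = tri c x y z + tri c x' y z"
  "tri c x (y + y') z = tri c x y z + tri c x y' z"
  "tri c x y (z + z') = tri c x y z + tri c x y z'"
  by (simp_all add: tri_def distrib_left distrib_right sum.distrib case_prod_beta)

lemma tri_scale:
  "tri c (a *s x) y z = a * tri c x y z"
  "tri c x (a *s y) z = a * tri c x y z"
  "tri c x y (a *s z) = a * tri c x y z"
  by (simp_all add: tri_def sum_distrib_left case_prod_beta mult_ac)

lemma prod_power_of_bool: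
  "(\<Prod>l\<in>UNIV. (x :: 'a::comm_ring_1 ^ 'i::finite) $ l ^ of_bool (l = i)) = x $ i"
proof -
  have "x $ l ^ of_bool (l = i) = (if l = i then x $ l else 1)" for l by simp
  thus ?thesis by (simp add: prod.delta)
qed

lemma ev_tri: "ev c x = tri c x x x"
  unfolding ev_def tri_def
proof (rule sum.cong[OF refl])
  fix e assume e: "e \<in> mons3"
  obtain i j k where t: "tri_index e = (i, j, k)" by (metis prod_cases3)
  show "c e * (\<Prod>i\<in>UNIV. x $ i ^ e $ i) = c e * (case tri_index e of (i, j, k) \<Rightarrow> x $ i * x $ j * x $ k)"
    by (simp add: t tri_index[OF e t] power_add prod.distrib prod_power_of_bool)
qed

lemma dev_pol: "dev c j x = pol c x (axis j 1)"
  unfolding dev_def pol_def tri_def sum.distrib[symmetric]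
proof (rule sum.cong[OF refl])
  fix e assume e: "e \<in> mons3"
  obtain i1 i2 i3 where t: "tri_index e = (i1, i2, i3)" by (metis prod_cases3)
  \<comment> \<open>Truncated subtraction in the exponent is harmless: when \<open>e $ j\<close> is
    zero, so is the factor \<open>of_nat (e $ j)\<close>.\<close>
  define p where "p = (\<Prod>i\<in>UNIV. x $ i ^ (if i = j then e $ i - 1 else e $ i))"
  note ix = tri_index[OF e t]
  have p: "p = x $ a * x $ b" if "\<And>l. e $ l = of_bool (l = j) + of_bool (l = a) + of_bool (l = b)" for a b
  proof -
    have "(if l = j then e $ l - 1 else e $ l) = of_bool (l = a) + of_bool (l = b)" for l
      by (simp add: that)
    thus ?thesis unfolding p_def by (simp add: power_add prod.distrib prod_power_of_bool)
  qed
  have 1: "of_bool (j = i1) * p = of_bool (j = i1) * (x $ i2 * x $ i3)"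
    using p[of i2 i3] ix by (cases "j = i1") auto
  have 2: "of_bool (j = i2) * p = of_bool (j = i2) * (x $ i1 * x $ i3)"
    using p[of i1 i3] ix by (cases "j = i2") (auto simp: add_ac)
  have 3: "of_bool (j = i3) * p = of_bool (j = i3) * (x $ i1 * x $ i2)"
    using p[of i1 i2] ix by (cases "j = i3") (auto simp: add_ac)
  have sum: "of_nat (e $ j) * p = of_bool (j = i1) * p + of_bool (j = i2) * p + of_bool (j = i3) * p"
    by (simp add: ix distrib_right)
  have "of_nat (e $ j) * c e * p = c e * (of_nat (e $ j) * p)" by (simp only: mult_ac)
  also have "\<dots> = c e * (of_bool (j = i1) * (x $ i2 * x $ i3)
      + of_bool (j = i2) * (x $ i1 * x $ i3) + of_bool (j = i3) * (x $ i1 * x $ i2))"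
    unfolding sum 1 2 3 ..
  finally have "of_nat (e $ j) * c e * p = c e * (of_bool (j = i1) * (x $ i2 * x $ i3)
      + of_bool (j = i2) * (x $ i1 * x $ i3) + of_bool (j = i3) * (x $ i1 * x $ i2))" .
  moreover have "axis j 1 $ i = (of_bool (j = i) :: 'a)" for i by (auto simp: axis_def)
  ultimately show "of_nat (e $ j) * c e * (\<Prod>i\<in>UNIV. x $ i ^ (if i = j then e $ i - 1 else e $ i)) =
         c e * (case tri_index e of (i, j', k) \<Rightarrow> axis j 1 $ i * x $ j' * x $ k) +
         c e * (case tri_index e of (i, j', k) \<Rightarrow> x $ i * axis j 1 $ j' * x $ k) +
         c e * (case tri_index e of (i, j', k) \<Rightarrow> x $ i * x $ j' * axis j 1 $ k)"
    unfolding p_def[symmetric] by (simp add: t algebra_simps)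
qed

lemma pol_add: "pol c x (y + z) = pol c x y + pol c x z"
  by (simp add: pol_def tri_add)

lemma pol_scale: "pol c x (a *s y) = a * pol c x y"
  by (simp add: pol_def tri_scale algebra_simps)

lemma pol_scale_left: "pol c (a *s x) y = a ^ 2 * pol c x y"
  by (simp add: pol_def tri_scale algebra_simps power2_eq_square)

lemma pol_add_left: "pol c (x + z) y = pol c x y + mix c x z y + pol c z y"
  by (simp add: pol_def mix_def tri_add)

lemma mix_scale: "mix c (a *s x) y z = a * mix c x y z" "mix c x (a *s y) z = a * mix c x y z"
  by (simp_all add: mix_def tri_scale algebra_simps)

lemma mix_same: "mix c x y x = 2 * pol c x y" "mix c x y y = 2 * pol c y x"
  by (simp_all add: mix_def pol_def)

lemma pol_same: "pol c x x = 3 * ev c x"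
  by (simp add: pol_def ev_tri)

lemma ev_add: "ev c (x + y) = ev c x + pol c x y + pol c y x + ev c y"
  by (simp add: ev_tri pol_def tri_add)

lemma ev_scale: "ev c (a *s x) = a ^ 3 * ev c x"
  by (simp add: ev_tri tri_scale power3_eq_cube mult_ac)

lemma ev_line: "ev c (s *s x + t *s y) =
    s ^ 3 * ev c x + s ^ 2 * t * pol c x y + s * t ^ 2 * pol c y x + t ^ 3 * ev c y"
  by (simp add: ev_add ev_scale pol_scale pol_scale_left mult_ac)

lemma tri_vmap: "tri (cbar c) (vmap x) (vmap y) (vmap z) = to_ac (tri c x y z)"
  by (simp add: tri_def cbar_def vmap_def to_ac_sum case_prod_beta)

lemma ev_vmap: "ev (cbar c) (vmap x) = to_ac (ev c x)"
  by (simp add: ev_tri tri_vmap)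

lemma pol_vmap: "pol (cbar c) (vmap x) (vmap y) = to_ac (pol c x y)"
  by (simp add: pol_def tri_vmap)

lemma mix_vmap: "mix (cbar c) (vmap x) (vmap y) (vmap z) = to_ac (mix c x y z)"
  by (simp add: mix_def tri_vmap)

subsection \<open>Cubic surfaces with two skew lines\<close>

lemma smul_eq: "smul a v = a *s v"
  by (simp add: smul_def vector_scalar_mult_def)

lemma vadd_eq: "vadd v w = v + w"
  by (simp add: vadd_def plus_vec_def)

lemma vzero_eq: "vzero = (0 :: 'a::zero^4)"
  by (simp add: vzero_def zero_vec_def)

lemma vmap_linear:
  "vmap (x + y) = vmap x + vmap y" "vmap (a *s x) = to_ac a *s vmap x"
  "vmap 0 = 0" "vmap (- x) = - vmap x" "vmap (axis j 1) = axis j 1"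
  by (simp_all add: vmap_def vec_eq_iff axis_def)

lemma line_of_iff: "v \<in> line_of x y \<longleftrightarrow> (\<exists>a b. v = a *s x + b *s y \<and> (a, b) \<noteq> (0, 0))"
  by (auto simp: line_of_def smul_eq vadd_eq)

lemma lines_on_line_of:
  assumes "line_of x y \<in> lines_on c"
  shows "v \<in> line_of x y \<Longrightarrow> ev (cbar c) v = 0" "0 \<notin> line_of x y"
proof -
  obtain x' y' where l: "line_of x y = line_of x' y'" "indep2 x' y'" "\<forall>v\<in>line_of x' y'. ev (cbar c) v = 0"
    using assms unfolding lines_on_def by blast
  show "v \<in> line_of x y \<Longrightarrow> ev (cbar c) v = 0" using l by simp
  show "0 \<notin> line_of x y"
    using l(1,2) by (auto simp: line_of_iff indep2_def smul_eq vadd_eq vzero_eq)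
qed

lemma ev_diff: "ev c (x - y) = ev c x - pol c x y + pol c y x - ev c y"
  using ev_line[of c 1 x "- 1" y] by (simp add: vector_smult_lneg)

lemma pol_minus: "pol c x (- y) = - pol c x y" "pol c (- x) y = pol c x y"
  using pol_scale[of c x "- 1" y] pol_scale_left[of c "- 1" x y] by (simp_all add: vector_smult_lneg)

lemma ev_minus: "ev c (- x) = - ev c x"
  using ev_scale[of c "- 1" x] by (simp add: vector_smult_lneg)

text \<open>A binary cubic with zeros at all four rational points of a line is the zero form, so
  these four values decide whether the line lies on the surface over the closure.\<close>

lemma line_on_values:
  assumes "ev c x = 0" "ev c y = 0" "ev c (x + y) = 0" "ev c (x - y) = 0"
  shows "pol c x y = 0" "pol c y x = 0" "ev (cbar c) (s *s vmap x + t *s vmap y) = 0"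
proof -
  have "pol c y x - pol c x y = 0" using assms by (simp add: ev_diff)
  moreover have "pol c x y + pol c y x = 0" using assms by (simp add: ev_add)
  ultimately show p: "pol c x y = 0" "pol c y x = 0"
    using f3_cases[of "pol c x y"] f3_cases[of "pol c y x"] by auto
  show "ev (cbar c) (s *s vmap x + t *s vmap y) = 0"
    by (simp add: ev_line ev_vmap pol_vmap assms p)
qed

locale two_lines =
  fixes c :: "nat^4 \<Rightarrow> f3" and u w u' w' :: "f3^4"
  assumes smooth: "smooth_cubic c"
    and line1: "K_line_on c u w" and line2: "K_line_on c u' w'"
    and skew: "skew u w u' w'"
begin

definition px :: "v2 \<Rightarrow> f3^4" where "px x = fst x *s u + snd x *s w"
definition py :: "v2 \<Rightarrow> f3^4" where "py y = fst y *s u' + snd y *s w'"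
definition al :: "v2 \<Rightarrow> v2 \<Rightarrow> f3" where "al x y = pol c (px x) (py y)"
definition be :: "v2 \<Rightarrow> v2 \<Rightarrow> f3" where "be x y = pol c (py y) (px x)"

lemma swap: "two_lines c u' w' u w"
  using smooth line1 line2 skew unfolding two_lines_def skew_def by blast

lemma px_linear: "px (x + z) = px x + px z" "px (x - z) = px x - px z" "px (- x) = - px x" "px 0 = 0"
  by (simp_all add: px_def vec_eq_iff algebra_simps)

lemma py_linear: "py (x + z) = py x + py z" "py (x - z) = py x - py z" "py (- x) = - py x" "py 0 = 0"
  by (simp_all add: py_def vec_eq_iff algebra_simps)

lemma lines: "line_of (vmap u) (vmap w) \<in> lines_on c" "line_of (vmap u') (vmap w') \<in> lines_on c"
  using line1 line2 by (simp_all add: K_line_on_def)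

lemma independent:
  assumes "a1 *s vmap u + a2 *s vmap w + (b1 *s vmap u' + b2 *s vmap w') = 0"
  shows "a1 = 0 \<and> a2 = 0 \<and> b1 = 0 \<and> b2 = 0"
proof -
  define v where "v = a1 *s vmap u + a2 *s vmap w"
  have v': "v = (- b1) *s vmap u' + (- b2) *s vmap w'"
    using assms unfolding v_def by (simp add: add_eq_0_iff2 vector_smult_lneg)
  have v1: "v \<in> line_of (vmap u) (vmap w)" if "(a1, a2) \<noteq> (0, 0)"
    using that unfolding line_of_iff v_def by blast
  have v2: "v \<in> line_of (vmap u') (vmap w')" if "(b1, b2) \<noteq> (0, 0)"
    using that unfolding line_of_iff v' by (intro exI[of _ "- b1"] exI[of _ "- b2"]) auto
  have "(a1, a2) = (0, 0)"
  proof (rule ccontr)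
    assume a: "(a1, a2) \<noteq> (0, 0)"
    hence "(b1, b2) = (0, 0)" using v1 v2 skew unfolding skew_def by blast
    hence "v = 0" using v' by simp
    thus False using v1 a lines_on_line_of(2)[OF lines(1)] by simp
  qed
  moreover from this have "v = 0" by (simp add: v_def)
  hence "(b1, b2) = (0, 0)" using v2 lines_on_line_of(2)[OF lines(2)] by metis
  ultimately show ?thesis by simp
qed

lemma vmap_pxy: "vmap (px x + py y) =
    to_ac (fst x) *s vmap u + to_ac (snd x) *s vmap w + (to_ac (fst y) *s vmap u' + to_ac (snd y) *s vmap w')"
  by (simp add: px_def py_def vmap_linear)

lemma pxy_zero: "px x + py y = 0 \<Longrightarrow> x = 0 \<and> y = 0"
proof -
  assume "px x + py y = 0"
  hence "vmap (px x + py y) = 0" by (simp add: vmap_linear)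
  from independent[OF this[unfolded vmap_pxy]] show ?thesis by (simp add: prod_eq_iff)
qed

lemma pxy_inj: "px x + py y = px x' + py y' \<longleftrightarrow> x = x' \<and> y = y'"
proof -
  have "px x + py y - (px x' + py y') = px (x - x') + py (y - y')"
    by (simp add: px_linear py_linear)
  thus ?thesis using pxy_zero[of "x - x'" "y - y'"] by auto
qed

text \<open>An injective map between two sets of 81 elements is onto.\<close>

lemma pxy_surj: "\<exists>x y. v = px x + py y"
proof -
  define h where "h = (\<lambda>(x, y). px x + py y)"
  have "inj h" using pxy_inj by (auto simp: inj_def h_def)
  hence "card (range h) = CARD(f3^4)" by (simp add: card_image card_three)
  hence "range h = UNIV" by (intro card_eq_UNIV_imp_eq_UNIV) simp_all
  hence "v \<in> range h" by simp
  thus ?thesis unfolding h_def by auto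
qed

lemma ev_px: "ev c (px x) = 0"
proof -
  have "ev (cbar c) (vmap (px x)) = 0"
  proof (cases "x = 0")
    case True
    thus ?thesis using ev_scale[of "cbar c" 0 0] by (simp add: px_linear vmap_linear)
  next
    case False
    have "vmap (px x) = to_ac (fst x) *s vmap u + to_ac (snd x) *s vmap w"
      by (simp add: px_def vmap_linear)
    hence "vmap (px x) \<in> line_of (vmap u) (vmap w)"
      using False unfolding line_of_iff by (metis Pair_inject prod.collapse to_ac_eq_0_iff zero_prod_def)
    thus ?thesis using lines_on_line_of(1)[OF lines(1)] by blast
  qed
  thus ?thesis by (simp add: ev_vmap)
qed

lemma ev_py: "ev c (py y) = 0"
  using two_lines.ev_px[OF swap, of y] two_lines.px_def[OF swap, of y] by (simp add: py_def)

lemma skew_cubic: "skew_cubic al be"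
proof
  fix x y z
  show "al x (y + z) = al x y + al x z" by (simp add: al_def py_linear pol_add)
  show "be (x + z) y = be x y + be z y" by (simp add: be_def px_linear pol_add)
  have quad: "pol c (a + b) d + pol c (a - b) d = - pol c a d - pol c b d" for a b d
  proof -
    have "mix c a (- b) d = - mix c a b d"
      using mix_scale(2)[of c a "- 1" b d] by (simp add: vector_smult_lneg)
    hence "pol c (a - b) d = pol c a d - mix c a b d + pol c b d"
      using pol_add_left[of c a "- b" d] by (simp add: pol_minus)
    hence "pol c (a + b) d + pol c (a - b) d = (pol c a d + pol c a d) + (pol c b d + pol c b d)"
      by (simp only: pol_add_left) (simp add: algebra_simps del: f3_sum3)
    thus ?thesis by simp
  qed
  show "al (x + z) y + al (x - z) y = - al x y - al z y" by (simp add: al_def px_linear quad)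
  show "be x (y + z) + be x (y - z) = - be x y - be x z" by (simp add: be_def py_linear quad)
qed

sublocale skew_cubic al be by (rule skew_cubic)

lemma F_ev: "F x y = ev c (px x + py y)"
  by (simp add: F_def al_def be_def ev_add ev_px ev_py)

lemma F_singular:
  assumes "x \<noteq> 0 \<or> y \<noteq> 0" "F x y = 0"
  shows "\<exists>v z. F (x - v) (y - z) - F (x + v) (y + z) \<noteq> F v z"
proof -
  define p where "p = px x + py y"
  have "p \<noteq> 0" using pxy_zero assms(1) unfolding p_def by blast
  hence "vmap p \<noteq> vzero" by (auto simp: vzero_eq vmap_def vec_eq_iff)
  moreover have "ev (cbar c) (vmap p) = 0" using assms(2) by (simp add: ev_vmap p_def F_ev)
  ultimately obtain j where "dev (cbar c) j (vmap p) \<noteq> 0"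
    using smooth unfolding smooth_cubic_def by blast
  hence ne: "pol c p (axis j 1) \<noteq> 0" unfolding dev_pol
    by (metis pol_vmap to_ac_0 vmap_linear(5))
  obtain v z where n: "axis j 1 = px v + py z" using pxy_surj by blast
  define n where "n = px v + py z"
  have pn: "pol c p n \<noteq> 0" using ne n n_def by simp
  have "F (x - v) (y - z) = ev c (p - n)" "F (x + v) (y + z) = ev c (p + n)" "F v z = ev c n"
    unfolding F_ev p_def n_def by (simp_all add: px_linear py_linear algebra_simps)
  \<comment> \<open>In characteristic three this combination isolates the derivative: the terms of
    second order cancel and the cubic terms add up to a multiple of 3.\<close>
  moreover have "ev c (p - n) - ev c (p + n) - ev c n = pol c p n"
    using f3_cases[of "pol c p n"] f3_cases[of "ev c n"]
    by (elim disjE) (simp_all add: ev_add ev_diff)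
  ultimately show ?thesis using pn by (metis cancel_comm_monoid_add_class.diff_cancel)
qed

lemma binary_quadratic_zero: "\<exists>s t :: fb. (s \<noteq> 0 \<or> t \<noteq> 0) \<and> a * s ^ 2 + b * (s * t) + d * t ^ 2 = 0"
proof (cases "d = 0")
  case True
  thus ?thesis by (intro exI[of _ 0] exI[of _ 1]) simp
next
  case False
  hence "degree [:a, b, d:] > 0" by simp
  then obtain t where "poly [:a, b, d:] t = 0" using alg_closed_imp_poly_has_root by blast
  thus ?thesis by (intro exI[of _ 1] exI[of _ t]) (simp add: algebra_simps power2_eq_square)
qed

text \<open>
  This needs a point that may not be rational: if \<open>al\<close> vanishes identically on $\ell \times \{y\}$, it splits off a binary
  quadratic form in $x$, and a zero of that form over the closure is a singular point of $S$ on $\ell$.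
\<close>

lemma al_nondegenerate:
  assumes "y \<noteq> 0"
  shows "\<exists>x. al x y \<noteq> 0"
proof (rule ccontr)
  assume "\<nexists>x. al x y \<noteq> 0"
  hence al0: "al x y = 0" for x by blast
  obtain y2 where det: "det2 y y2 \<noteq> 0"
  proof -
    have "det2 y (0, 1) \<noteq> 0 \<or> det2 y (1, 0) \<noteq> 0" using assms by (auto simp: det2_def prod_eq_iff)
    thus ?thesis using that by blast
  qed
  \<comment> \<open>Along the second line the derivative at points of the first is a pair of
    quadratic forms. The one for y vanishes by assumption, and (s, t) is a zero of the one for
    y2.\<close>
  obtain s t where st: "s \<noteq> 0 \<or> t \<noteq> 0"
    "to_ac (pol c u (py y2)) * s ^ 2 + to_ac (mix c u w (py y2)) * (s * t) + to_ac (pol c w (py y2)) * t ^ 2 = 0"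
    using binary_quadratic_zero by blast
  define q where "q = s *s vmap u + t *s vmap w"
  have "q \<in> line_of (vmap u) (vmap w)" using st(1) unfolding q_def line_of_iff by blast
  hence "q \<noteq> vzero" "ev (cbar c) q = 0"
    using lines_on_line_of[OF lines(1)] by (auto simp: vzero_eq)
  then obtain j where "dev (cbar c) j q \<noteq> 0" using smooth unfolding smooth_cubic_def by blast
  hence ne: "pol (cbar c) q (vmap (axis j 1)) \<noteq> 0" by (simp add: dev_pol vmap_linear)
  obtain a b where ab: "axis j 1 = px a + py b" using pxy_surj by blast
  have polq: "pol (cbar c) q (vmap n) =
      s ^ 2 * to_ac (pol c u n) + s * t * to_ac (mix c u w n) + t ^ 2 * to_ac (pol c w n)" for n
    by (simp add: q_def pol_add_left pol_scale_left mix_scale pol_vmap mix_vmap mult_ac)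
  have vals: "ev c u = 0" "ev c w = 0" "ev c (u + w) = 0" "ev c (u - w) = 0"
    using ev_px[of "(1, 0)"] ev_px[of "(0, 1)"] ev_px[of "(1, 1)"] ev_px[of "(1, - 1)"]
    by (simp_all add: px_def vector_smult_lneg)
  have polu: "pol (cbar c) q (vmap u) = 0" "pol (cbar c) q (vmap w) = 0"
    unfolding polq using line_on_values[OF vals] by (simp_all add: mix_same pol_same)
  have mixy: "pol c u (py y) = 0" "pol c w (py y) = 0" "mix c u w (py y) = 0"
  proof -
    show p: "pol c u (py y) = 0" "pol c w (py y) = 0"
      using al0[of "(1, 0)"] al0[of "(0, 1)"] by (simp_all add: al_def px_def)
    show "mix c u w (py y) = 0"
      using al0[of "(1, 1)"] p by (simp add: al_def px_def pol_add_left)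
  qed
  define L where "L v = pol (cbar c) q (vmap (py v))" for v
  have L: "L (x + z) = L x + L z" "L (x - z) = L x - L z" "L (- x) = - L x" "L 0 = 0" for x z
    using pol_scale[of "cbar c" q 0 0]
    by (simp_all add: L_def py_linear vmap_linear pol_add pol_minus diff_conv_add_uminus del: add_uminus_conv_diff)
  have "L y = 0" "L y2 = 0"
    unfolding L_def polq using mixy st(2) by (simp_all add: mult_ac)
  hence "L b = 0" using v2_span[OF det, of b] by (elim insertE emptyE) (simp_all add: L)
  moreover have "pol (cbar c) q (vmap (px a)) = 0"
    using polu by (simp add: px_def vmap_linear pol_add pol_scale)
  ultimately show False using ne unfolding ab by (simp add: vmap_linear pol_add L_def)
qed

lemma be_nondegenerate: "x \<noteq> 0 \<Longrightarrow> \<exists>y. be x y \<noteq> 0"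
  using two_lines.al_nondegenerate[OF swap]
  by (simp add: be_def two_lines.al_def[OF swap] two_lines.px_def[OF swap] two_lines.py_def[OF swap] px_def py_def)

sublocale smooth_skew_cubic al be
  by unfold_locales (fact al_nondegenerate be_nondegenerate F_singular)+

section \<open>Rational Eckardt points from ramification\<close>

lemma line_of_in_lines_on:
  assumes "\<And>a b. a *s vmap p + b *s vmap r = 0 \<Longrightarrow> a = 0 \<and> b = 0"
    and "ev c p = 0" "ev c r = 0" "ev c (p + r) = 0" "ev c (p - r) = 0"
  shows "line_of (vmap p) (vmap r) \<in> lines_on c"
proof -
  have "indep2 (vmap p) (vmap r)" using assms(1) by (simp add: indep2_def smul_eq vadd_eq vzero_eq)
  moreover have "\<forall>v\<in>line_of (vmap p) (vmap r). ev (cbar c) v = 0"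
    using line_on_values(3)[OF assms(2-5)] by (auto simp: line_of_iff)
  ultimately show ?thesis unfolding lines_on_def by blast
qed

lemma independent_eq:
  assumes "a1 *s vmap u + a2 *s vmap w + (b1 *s vmap u' + b2 *s vmap w') =
    d1 *s vmap u + d2 *s vmap w + (e1 *s vmap u' + e2 *s vmap w')"
  shows "a1 = d1 \<and> a2 = d2 \<and> b1 = e1 \<and> b2 = e2"
proof -
  have "(a1 - d1) *s vmap u + (a2 - d2) *s vmap w + ((b1 - e1) *s vmap u' + (b2 - e2) *s vmap w') = 0"
    using assms by (simp add: vec_eq_iff algebra_simps)
  from independent[OF this] show ?thesis by simp
qed

text \<open>The three lines are $\ell$, the transversal to $f(p)$, and the rest of the tangent plane section.\<close>

lemma eckardt_point:
  assumes r: "ramified (dirmap al) p" and fp: "dirmap (\<lambda>y x. be x y) (dirmap al p) = p"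
  shows "eckardt c (vmap (px (rep p)))"
proof -
  interpret dual: smooth_skew_cubic "\<lambda>y x. be x y" "\<lambda>y x. al x y"
    by (rule smooth_skew_cubic_dual) unfold_locales
  define x y where "x = rep p" and "y = rep (dirmap al p)"
  have al0: "al x y = 0" by (simp only: x_def y_def al_rep)
  have be0: "be x y = 0" unfolding x_def y_def dual.al_rep fp ..
  obtain q where "q \<noteq> p" by (metis pt.distinct(1))
  define z where "z = rep q"
  have det: "det2 x z \<noteq> 0" using \<open>q \<noteq> p\<close> by (auto simp: x_def z_def det2_rep)
  have aln: "al v y \<noteq> 0" if "det2 x v \<noteq> 0" for v
  proof -
    have "v \<noteq> 0" using that by (auto simp: det2_def)
    then obtain t where t: "dir v t" by (rule dir_exists)
    hence "t \<noteq> p" using that dir_eq[of x p v t] by (auto simp: x_def)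
    thus ?thesis using al_dir[OF t, of y "dirmap al p"] r by (auto simp: y_def ramified_def)
  qed
  have "al z y \<noteq> 0" "al (x + z) y \<noteq> 0" "al (x - z) y \<noteq> 0"
    using det by (auto intro!: aln simp: det2_def algebra_simps)
  \<comment> \<open>Ramification leaves three nonzero values with sum zero, which are therefore
    equal.\<close>
  hence alz: "al (x + z) y = al z y" "al (x - z) y = al z y"
    using al_quad[of x z y] al0 f3_cases[of "al z y"] f3_cases[of "al (x + z) y"] f3_cases[of "al (x - z) y"]
    by auto
  obtain t where "be t y \<noteq> 0" using dual.al_nonzero'[of y] by (auto simp: y_def)
  hence "be z y \<noteq> 0" using v2_span[OF det, of t] be0
    by (elim insertE emptyE) (auto simp: be_add be_diff)
  \<comment> \<open>The sign puts (z, y') on the surface; the equal values of \<open>al\<close> then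
    put the whole line from x through (z, y') on it.\<close>
  define y' where "y' = (if al z y = be z y then - y else y)"
  have y'0: "y' \<noteq> 0" by (simp add: y'_def y_def)
  have Fz: "al z y' + be z y' = 0" "al (x + z) y' = al z y'" "al (x - z) y' = al z y'" "be x y' = 0"
    using \<open>al z y \<noteq> 0\<close> \<open>be z y \<noteq> 0\<close> f3_cases[of "al z y"] f3_cases[of "be z y"] alz be0
    by (auto simp: y'_def)
  define L1 L2 L3 where "L1 = line_of (vmap u) (vmap w)" and "L2 = line_of (vmap (px x)) (vmap (py y))"
    and "L3 = line_of (vmap (px x)) (vmap (px z + py y'))"
  have vx: "vmap (px v) = to_ac (fst v) *s vmap u + to_ac (snd v) *s vmap w" for v
    by (simp add: px_def vmap_linear)
  have vy: "vmap (py v) = to_ac (fst v) *s vmap u' + to_ac (snd v) *s vmap w'" for v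
    by (simp add: py_def vmap_linear)
  have comb: "a *s vmap (px v) + b *s vmap (px t + py s) =
      (a * to_ac (fst v) + b * to_ac (fst t)) *s vmap u + (a * to_ac (snd v) + b * to_ac (snd t)) *s vmap w +
      ((b * to_ac (fst s)) *s vmap u' + (b * to_ac (snd s)) *s vmap w')" for a b v t s
    by (simp add: vmap_linear vx vy vec_eq_iff algebra_simps)
  have indep: "a = 0 \<and> b = 0" if "a *s vmap (px x) + b *s vmap (px t + py s) = 0" "s \<noteq> 0" for a b t s
  proof -
    from independent[OF that(1)[unfolded comb]] have b: "b = 0" using that(2) by (auto simp: prod_eq_iff)
    hence "a = 0" using independent[OF that(1)[unfolded comb]] rep_nonzero[of p]
      by (auto simp: x_def prod_eq_iff)
    thus ?thesis using b by simp
  qed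
  have y0: "px 0 + py y = py y" by (simp add: px_linear)
  have yn: "y \<noteq> 0" by (simp add: y_def)
  have "L1 \<in> lines_on c" using lines by (simp add: L1_def)
  moreover have "L2 \<in> lines_on c" unfolding L2_def
  proof (rule line_of_in_lines_on)
    show "a = 0 \<and> b = 0" if "a *s vmap (px x) + b *s vmap (py y) = 0" for a b
      using indep[OF _ yn, of a b 0] that by (simp add: y0)
    show "ev c (px x + py y) = 0" "ev c (px x - py y) = 0"
      using F_ev[of x y] F_ev[of x "- y"] al0 be0 by (simp_all add: F_def py_linear)
  qed (simp_all add: ev_px ev_py)
  moreover have "L3 \<in> lines_on c" unfolding L3_def
  proof (rule line_of_in_lines_on)
    show "a = 0 \<and> b = 0" if "a *s vmap (px x) + b *s vmap (px z + py y') = 0" for a b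
      using indep[OF that y'0] .
    show "ev c (px z + py y') = 0" using F_ev[of z y'] Fz by (simp add: F_def)
    have sums: "px x + (px z + py y') = px (x + z) + py y'" "px x - (px z + py y') = px (x - z) + py (- y')"
      by (simp_all add: px_linear py_linear)
    show "ev c (px x + (px z + py y')) = 0" "ev c (px x - (px z + py y')) = 0"
      unfolding sums F_ev[symmetric] using Fz by (simp_all add: F_def be_add be_diff add_eq_0_iff)
  qed (simp add: ev_px)
  moreover have n1: "vmap (px t + py s) \<notin> L1" if "s \<noteq> 0" for t s
  proof
    assume "vmap (px t + py s) \<in> L1"
    then obtain a b where "vmap (px t + py s) = a *s vmap u + b *s vmap w + (0 *s vmap u' + 0 *s vmap w')"
      unfolding L1_def line_of_iff by auto
    from independent_eq[OF this[unfolded vmap_pxy]] show False using that by (simp add: prod_eq_iff)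
  qed
  have on: "v \<in> line_of v r" "r \<in> line_of v r" for v r :: "fb^4"
    unfolding line_of_iff by (intro exI[of _ 1] exI[of _ 0], simp) (intro exI[of _ 0] exI[of _ 1], simp)
  have "vmap (px z + py y') \<notin> L2"
  proof
    assume "vmap (px z + py y') \<in> L2"
    then obtain a b where "vmap (px z + py y') = a *s vmap (px x) + b *s vmap (px 0 + py y)"
      unfolding L2_def line_of_iff by (auto simp: y0)
    from independent_eq[OF this[unfolded comb, unfolded vmap_pxy]]
    have "to_ac (fst z) = a * to_ac (fst x)" "to_ac (snd z) = a * to_ac (snd x)" by simp_all
    hence "to_ac (det2 x z) = 0" by (simp add: det2_def)
    thus False using det by simp
  qed
  moreover have "vmap (px z + py y') \<in> L3" "vmap (px x) \<in> L3" "vmap (px x) \<in> L2" "vmap (py y) \<in> L2"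
    unfolding L2_def L3_def by (rule on)+
  moreover have "vmap (py y) \<notin> L1" using n1[OF yn, of 0] by (simp add: y0)
  moreover have "vmap (px x) \<in> L1"
    using rep_nonzero[of p] unfolding L1_def line_of_iff vx x_def[symmetric]
    by (intro exI[of _ "to_ac (fst x)"] exI[of _ "to_ac (snd x)"]) (auto simp: prod_eq_iff)
  moreover have "vmap (px x) \<noteq> vzero"
    using lines_on_line_of(2)[OF lines(1)] \<open>vmap (px x) \<in> L1\<close> by (auto simp: L1_def vzero_eq)
  moreover have "vmap (px z + py y') \<notin> L1" using n1 y'0 .
  ultimately show ?thesis
    unfolding eckardt_def x_def[symmetric] by (auto simp: ev_vmap ev_px)
qed

lemma px_Kpts_line: "x \<noteq> 0 \<Longrightarrow> px x \<in> Kpts_line u w"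
  unfolding Kpts_line_def smul_eq vadd_eq px_def
  by (intro CollectI exI[of _ "fst x"] exI[of _ "snd x"]) (auto simp: prod_eq_iff)

lemma unique_eckardt_px:
  assumes "at_most_one_K_eckardt c u w"
  shows "unique_eckardt (dirmap al) (dirmap (\<lambda>y x. be x y))"
  unfolding unique_eckardt_def
proof (intro allI impI)
  fix p q
  assume "ramified (dirmap al) p" "dirmap (\<lambda>y x. be x y) (dirmap al p) = p"
    and "ramified (dirmap al) q" "dirmap (\<lambda>y x. be x y) (dirmap al q) = q"
  hence e: "eckardt c (vmap (px (rep p)))" "eckardt c (vmap (px (rep q)))"
    using eckardt_point by blast+
  hence "kpt (px (rep p)) = kpt (px (rep q))"
    using assms px_Kpts_line unfolding at_most_one_K_eckardt_def by simp
  moreover have "px (rep q) \<in> kpt (px (rep q))"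
    unfolding kpt_def smul_eq by (intro CollectI exI[of _ 1]) simp
  ultimately obtain a where a: "px (rep q) = a *s px (rep p)" "a \<noteq> 0"
    unfolding kpt_def smul_eq by blast
  hence "px (rep q) + py 0 = px (rep p) + py 0 \<or> px (rep q) + py 0 = px (- rep p) + py 0"
    using f3_cases[of a] by (auto simp: px_linear vector_smult_lneg)
  hence "dir (rep q) p" unfolding pxy_inj dir_def by simp
  thus "p = q" using dir_eq[of "rep q" p "rep q" q] by (simp add: det2_def)
qed

section \<open>The span as a closed set\<close>

lemma kpt_minus: "kpt (- v) = kpt v"
proof -
  have "kpt (- v) \<subseteq> kpt v" for v
  proof
    fix z assume "z \<in> kpt (- v)"
    then obtain a where "z = (- a) *s v" "a \<noteq> 0"
      unfolding kpt_def smul_eq by (auto simp: vector_smult_lneg vector_smult_rneg)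
    thus "z \<in> kpt v" unfolding kpt_def smul_eq by (intro CollectI exI[of _ "- a"]) simp
  qed
  from this[of v] this[of "- v"] show ?thesis by simp
qed

lemma Bstep_mono: "n \<le> m \<Longrightarrow> R \<in> SK c \<Longrightarrow> R \<in> Bstep c B n \<Longrightarrow> R \<in> Bstep c B m"
  by (induction m rule: dec_induct) auto

lemma Span_third:
  assumes "P \<in> Span c B" "Q \<in> Span c B" "P \<in> SK c" "Q \<in> SK c" "R \<in> SK c" "third c P Q R"
  shows "R \<in> Span c B"
proof -
  obtain n m where "P \<in> Bstep c B n" "Q \<in> Bstep c B m" using assms(1,2) unfolding Span_def by blast
  hence "P \<in> Bstep c B (max n m)" "Q \<in> Bstep c B (max n m)"
    using Bstep_mono assms(3,4) by (meson max.cobounded1 max.cobounded2)+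
  hence "R \<in> Bstep c B (Suc (max n m))" using assms(5,6) by auto
  thus ?thesis unfolding Span_def by blast
qed

lemma Span_subset:
  assumes "B \<subseteq> SK c" shows "Span c B \<subseteq> SK c"
proof -
  have "Bstep c B n \<subseteq> SK c" for n by (cases n) (use assms in auto)
  thus ?thesis unfolding Span_def by blast
qed

lemma SK_intro: "v \<noteq> 0 \<Longrightarrow> ev c v = 0 \<Longrightarrow> kpt v \<in> SK c"
  unfolding SK_def vzero_eq by blast

text \<open>Proportional p and r would make p + r and p - r multiples of one zero of the cubic,
  hence zeros as well.\<close>

lemma third_line:
  assumes "ev c p = 0" "ev c r = 0" "ev c (p + r) \<noteq> 0 \<or> ev c (p - r) \<noteq> 0"
  shows "p \<noteq> 0" "r \<noteq> 0" "p + r \<noteq> 0" "indep2 p r"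
    "\<not> (\<forall>x\<in>line_of (vmap p) (vmap r). ev (cbar c) x = 0)"
proof -
  have pr: "ev c (p + p) = 0" using assms(1) ev_line[of c 1 p 1 p] by (simp add: pol_same)
  show ne: "p \<noteq> 0" "r \<noteq> 0" using assms ev_minus[of c r] by auto
  have nm: "p \<noteq> - r" "p \<noteq> r"
    using assms pr ev_scale[of c 0 0] ev_minus[of c "p + p"] by auto
  hence "- p \<noteq> r" by auto
  show "p + r \<noteq> 0" using nm by (simp add: add_eq_0_iff2)
  have "a = 0 \<and> b = 0" if "a *s p + b *s r = 0" for a b
    using f3_cases[of a] f3_cases[of b] that ne nm \<open>- p \<noteq> r\<close>
    by (elim disjE) (simp_all add: vector_smult_lneg add_eq_0_iff2)
  thus "indep2 p r" by (simp add: indep2_def smul_eq vadd_eq vzero_eq)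
  have "vmap (p + r) \<in> line_of (vmap p) (vmap r)"
    unfolding line_of_iff by (intro exI[of _ 1]) (simp add: vmap_linear)
  moreover have "vmap (p - r) \<in> line_of (vmap p) (vmap r)"
    unfolding line_of_iff
    by (intro exI[of _ 1] exI[of _ "- 1"])
      (simp add: vmap_linear vector_smult_lneg diff_conv_add_uminus del: add_uminus_conv_diff)
  ultimately show "\<not> (\<forall>x\<in>line_of (vmap p) (vmap r). ev (cbar c) x = 0)"
    using assms(3) by (metis ev_vmap to_ac_eq_0_iff)
qed

lemma third_tangent:
  assumes "ev c p = 0" "ev c r = 0" "ev c (p + r) = ev c (p - r)" "ev c (p + r) \<noteq> 0"
  shows "third c (kpt p) (kpt p) (kpt r)"
proof -
  have pol: "pol c p r = 0" "pol c r p \<noteq> 0"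
    using assms f3_cases[of "pol c p r"] by (auto simp: ev_add ev_diff)
  note line = third_line(4,5)[OF assms(1,2) disjI1[OF assms(4)]]
  \<comment> \<open>On this line the cubic is \<open>pol c r p\<close> times s t^2, with the double
    root (1, 0) at p and the simple root (0, 1) at r.\<close>
  show ?thesis unfolding third_def smul_eq vadd_eq ev_line
    by (rule exI[of _ p], rule exI[of _ r], rule exI[of _ 1], rule exI[of _ 0], rule exI[of _ 1],
        rule exI[of _ 0], rule exI[of _ 0], rule exI[of _ 1], rule exI[of _ "to_ac (pol c r p)"])
      (use pol line in \<open>simp add: ev_vmap pol_vmap assms power2_eq_square\<close>)
qed

lemma third_chord:
  assumes "ev c p = 0" "ev c r = 0" "ev c (p + r) = 0" "ev c (p - r) \<noteq> 0"
  shows "third c (kpt p) (kpt r) (kpt (p + r))"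
proof -
  define d where "d = pol c p r"
  have d: "pol c r p = - d" "d \<noteq> 0"
    using assms by (auto simp: ev_add ev_diff d_def add_eq_0_iff)
  note line = third_line(4,5)[OF assms(1,2) disjI2[OF assms(4)]]
  \<comment> \<open>On this line the cubic is \<open>d\<close> times s t (s - t), with roots (1, 0),
    (0, 1) and (1, 1); the signs of the linear factors account for \<open>- to_ac d\<close>.\<close>
  show ?thesis unfolding third_def smul_eq vadd_eq ev_line
    by (rule exI[of _ p], rule exI[of _ r], rule exI[of _ 1], rule exI[of _ 0], rule exI[of _ 0],
        rule exI[of _ 1], rule exI[of _ 1], rule exI[of _ 1], rule exI[of _ "- to_ac d"])
      (use d line in \<open>simp add: ev_vmap pol_vmap assms power2_eq_square algebra_simps flip: d_def\<close>)
qed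

lemma closed_set_Span: "closed_set al be (\<lambda>x y. kpt (px x + py y) \<in> Span c B)"
proof (intro closed_set.intro closed_set_axioms.intro)
  show "skew_cubic al be" by (rule skew_cubic)
  fix x y
  assume "kpt (px x + py y) \<in> Span c B"
  thus "kpt (px (- x) + py (- y)) \<in> Span c B"
    using kpt_minus[of "px x + py y"] by (simp add: px_linear py_linear)
next
  fix x y x' y'
  define p r where "p = px x + py y" and "r = px x' + py y'"
  have pr: "px (x + x') + py (y + y') = p + r" "px (x - x') + py (y - y') = p - r"
    by (simp_all add: p_def r_def px_linear py_linear)
  {
    assume a: "kpt p \<in> Span c B" "ev c p = 0" "ev c r = 0" "ev c (p + r) = ev c (p - r)" "ev c (p + r) \<noteq> 0"
    note third_tangent[OF a(2-5)] SK_intro third_line(1,2)[OF a(2,3) disjI1[OF a(5)]]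
    hence "kpt r \<in> Span c B" using Span_third a by blast
  }
  thus "kpt (px x + py y) \<in> Span c B \<Longrightarrow> F x y = 0 \<Longrightarrow> F x' y' = 0 \<Longrightarrow>
      F (x + x') (y + y') = F (x - x') (y - y') \<Longrightarrow> F (x + x') (y + y') \<noteq> 0 \<Longrightarrow>
      kpt (px x' + py y') \<in> Span c B"
    unfolding F_ev pr p_def[symmetric] r_def[symmetric] by blast
  {
    assume a: "kpt p \<in> Span c B" "kpt r \<in> Span c B" "ev c p = 0" "ev c r = 0" "ev c (p + r) = 0" "ev c (p - r) \<noteq> 0"
    note third_chord[OF a(3-6)] SK_intro third_line(1,2,3)[OF a(3,4) disjI2[OF a(6)]]
    hence "kpt (p + r) \<in> Span c B" using Span_third a by blast
  }
  thus "kpt (px x + py y) \<in> Span c B \<Longrightarrow> kpt (px x' + py y') \<in> Span c B \<Longrightarrow> F x y = 0 \<Longrightarrow>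
      F x' y' = 0 \<Longrightarrow> F (x + x') (y + y') = 0 \<Longrightarrow> F (x - x') (y - y') \<noteq> 0 \<Longrightarrow>
      kpt (px (x + x') + py (y + y')) \<in> Span c B"
    unfolding F_ev pr p_def[symmetric] r_def[symmetric] by blast
qed

end

theorem theorem2:
  fixes c :: "nat^4 \<Rightarrow> f3" and u w u' w' :: "f3^4"
  assumes "smooth_cubic c"
    and "K_line_on c u w" and "K_line_on c u' w'"
    and "skew u w u' w'"
    and "at_most_one_K_eckardt c u w" and "at_most_one_K_eckardt c u' w'"
  shows "\<exists>v. (v \<in> Kpts_line u w \<or> v \<in> Kpts_line u' w') \<and> Span c {kpt v} = SK c"
proof -
  interpret two_lines c u w u' w' using assms(1-4) by unfold_locales
  interpret swap: two_lines c u' w' u w by (rule swap)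
  \<comment> \<open>Exchanging the lines exchanges \<open>al\<close> and \<open>be\<close>, so the
    assumption on the second line becomes the dual uniqueness statement.\<close>
  have swap_eq: "swap.al = (\<lambda>y x. be x y)" "swap.be = (\<lambda>y x. al x y)"
    by (auto simp: fun_eq_iff al_def be_def swap.al_def swap.be_def px_def py_def swap.px_def swap.py_def)
  from generation_by_one_point[OF unique_eckardt_px[OF assms(5)]
      swap.unique_eckardt_px[OF assms(6), unfolded swap_eq]]
  obtain x y where xy: "x = 0 \<longleftrightarrow> y \<noteq> 0"
    and gen: "\<forall>G a b. closed_set al be G \<longrightarrow> G x y \<longrightarrow> a \<noteq> 0 \<or> b \<noteq> 0 \<longrightarrow> F a b = 0 \<longrightarrow> G a b"
    by (elim exE conjE)
  define v where "v = px x + py y"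
  have v: "v \<noteq> 0" "ev c v = 0"
  proof -
    show "v \<noteq> 0" using pxy_zero[of x y] xy unfolding v_def by metis
    show "ev c v = 0"
    proof (cases "x = 0")
      case True
      thus ?thesis by (simp add: v_def px_linear ev_py)
    next
      case False
      hence "y = 0" using xy by metis
      thus ?thesis by (simp add: v_def py_linear ev_px)
    qed
  qed
  hence kv: "kpt v \<in> SK c" by (rule SK_intro)
  \<comment> \<open>The span of v contains v at stage 0, so it can serve as \<open>G\<close> in
    \<open>gen\<close>.\<close>
  have "kpt v \<in> Bstep c {kpt v} 0" by simp
  hence "kpt v \<in> Span c {kpt v}" unfolding Span_def by blast
  hence "kpt (px a + py b) \<in> Span c {kpt v}" if "a \<noteq> 0 \<or> b \<noteq> 0" "F a b = 0" for a b
    using gen[rule_format, OF closed_set_Span[of "{kpt v}"], of a b] that by (simp add: v_def)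
  note span = this
  have "R \<in> Span c {kpt v}" if R: "R \<in> SK c" for R
  proof -
    obtain z where z: "R = kpt z" "z \<noteq> 0" "ev c z = 0" using R unfolding SK_def vzero_eq by blast
    obtain a b where ab: "z = px a + py b" using pxy_surj by blast
    have "a \<noteq> 0 \<or> b \<noteq> 0" using z(2) by (auto simp: ab px_linear py_linear)
    thus ?thesis using span[of a b] z unfolding ab F_ev by blast
  qed
  hence "Span c {kpt v} = SK c" using Span_subset[of "{kpt v}"] kv by blast
  moreover have "v \<in> Kpts_line u w \<or> v \<in> Kpts_line u' w'"
  proof (cases "x = 0")
    case True
    hence "v = py y" "y \<noteq> 0" using xy by (simp_all add: v_def px_linear)
    thus ?thesis using swap.px_Kpts_line[of y] by (simp add: swap.px_def py_def)
  next
    case False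
    thus ?thesis using px_Kpts_line[of x] xy by (simp add: v_def py_linear)
  qed
  ultimately show ?thesis by blast
qed

end
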